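(* Let $(q_k)_{k\ge 1}$ be a sequence of positive integers with $q_{k+1}\ge q_k(q_k+1)$ for all $k\ge 1$, let $(\xi_k)_{k\ge1}$ be independent random variables with $\mathsf{P}\{\xi_k=0\}=p_{0k}$, $\mathsf{P}\{\xi_k=1\}=p_{1k}$, $p_{0k},p_{1k}\ge 0$, $p_{0k}+p_{1k}=1$, and assume that $\max\{p_{0k},p_{1k}\}<1$ for infinitely many $k$. Let $\mu$ be the distribution of $$\xi=\sum_{k=1}^\infty \frac{(-1)^{k+1}\xi_k}{q_k},$$ and let $S_\mu$ be its spectrum. Let $\nu_r$ be the distribution of $$\xi_r=\sum_{k=1}^\infty\frac{(-1)^{k+1}\varepsilon_k}{q_k},$$ where $\varepsilon_k$ are independent random variables taking the values $0$ and $1$ with probability $\frac12$ each. Let $h_n=-(p_{0n}\ln p_{0n}+p_{1n}\ln p_{1n})$ (with $0\ln0=0$) and $H_n=h_1+\dots+h_n$. Then $$\dim_H(\mu,\nu_r)=\liminf_{n\to\infty}\frac{H_n}{n\ln2},$$ and $$\dim_H(S_\mu,\nu_r)=\liminf_{k\to\infty}\frac{N_k}{k},\qquad\text{where } N_k=\#\{j:\ j\le k,\ p_{0j}p_{1j}>0\}.$$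
   Context: The spectrum $S_\mu$ of $\mu$ is its minimal closed support. For a continuous (atomless) probability measure $\nu$ on $\mathbb{R}$, a bounded set $E\subset\mathbb{R}$ and $\alpha>0$, put $$H^\alpha(E,\nu)=\lim_{\varepsilon\to0}\ \inf\Big\{\sum_j(\nu(E_j))^\alpha\Big\},$$ where the infimum is over all at most countable coverings $\{E_j\}$ of $E$ by closed intervals with $\nu(E_j)\le\varepsilon$ (one may restrict to subintervals of a fixed bounded closed interval containing $E$). The Hausdorff–Billingsley dimension of $E$ with respect to $\nu$ is $\dim_H(E,\nu)=\inf\{\alpha>0: H^\alpha(E,\nu)=0\}$. The Hausdorff–Billingsley dimension of a probability measure $\mu$ (with bounded support) with respect to $\nu$ is $\dim_H(\mu,\nu)=\inf\{\dim_H(E,\nu): E \text{ a bounded Borel set},\ \mu(E)=1\}$. *)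

theory Defs
  imports "HOL-Probability.Probability"
begin

definition ostrogradsky_sum :: "(nat \<Rightarrow> nat) \<Rightarrow> (nat \<Rightarrow> real) \<Rightarrow> real" where
  "ostrogradsky_sum q x = (\<Sum>k. (-1) ^ (Suc k + 1) * x (Suc k) / real (q (Suc k)))"
  \<comment> \<open>the series runs over the indices \<open>1, 2, 3, \<dots>\<close>; the values \<open>q 0\<close> and \<open>x 0\<close> are ignored\<close>

definition spectrum :: "real measure \<Rightarrow> real set" where
  "spectrum \<mu> = \<Inter>{F. closed F \<and> measure \<mu> F = 1}"

definition interval_covers :: "real measure \<Rightarrow> real set \<Rightarrow> real \<Rightarrow> real set set set" where
  "interval_covers \<nu> E \<epsilon> = {C. countable C \<and> C \<subseteq> {{a..b} | a b. a \<le> b} \<and> E \<subseteq> \<Union>C \<and>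
     (\<forall>I\<in>C. measure \<nu> I \<le> \<epsilon>)}"

definition hb_premeasure :: "real \<Rightarrow> real \<Rightarrow> real measure \<Rightarrow> real set \<Rightarrow> ennreal" where
  "hb_premeasure \<alpha> \<epsilon> \<nu> E =
     (INF C\<in>interval_covers \<nu> E \<epsilon>. \<Sum>\<^sub>\<infinity>I\<in>C. ennreal (measure \<nu> I powr \<alpha>))"

definition hb_measure :: "real \<Rightarrow> real measure \<Rightarrow> real set \<Rightarrow> ennreal" where
  "hb_measure \<alpha> \<nu> E = Lim (at_right 0) (\<lambda>\<epsilon>. hb_premeasure \<alpha> \<epsilon> \<nu> E)"

text \<open>The limit always exists, because the infimum does not decrease when \<open>\<epsilon>\<close> shrinks.\<close>

lemma hb_premeasure_antimono:
  assumes "\<epsilon> \<le> \<delta>"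
  shows "hb_premeasure \<alpha> \<delta> \<nu> E \<le> hb_premeasure \<alpha> \<epsilon> \<nu> E"
  unfolding hb_premeasure_def
  by (rule INF_superset_mono) (use assms in \<open>auto simp: interval_covers_def intro: order_trans\<close>)

lemma tendsto_hb_premeasure:
  "((\<lambda>\<epsilon>. hb_premeasure \<alpha> \<epsilon> \<nu> E) \<longlongrightarrow> (SUP \<epsilon>\<in>{0<..}. hb_premeasure \<alpha> \<epsilon> \<nu> E)) (at_right 0)"
proof (rule order_tendstoI)
  fix a assume "a < (SUP \<epsilon>\<in>{0<..}. hb_premeasure \<alpha> \<epsilon> \<nu> E)"
  then obtain d where d: "d > 0" "a < hb_premeasure \<alpha> d \<nu> E"
    by (auto simp: less_SUP_iff)
  have "\<forall>\<^sub>F \<epsilon> in at_right 0. \<epsilon> \<in> {0<..<d}"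
    using d(1) by (rule eventually_at_right_real)
  then show "\<forall>\<^sub>F \<epsilon> in at_right 0. a < hb_premeasure \<alpha> \<epsilon> \<nu> E"
    by eventually_elim
      (use d(2) in \<open>auto intro: less_le_trans[OF _ hb_premeasure_antimono]\<close>)
next
  fix a assume a: "(SUP \<epsilon>\<in>{0<..}. hb_premeasure \<alpha> \<epsilon> \<nu> E) < a"
  have "\<forall>\<^sub>F \<epsilon> in at_right (0::real). \<epsilon> \<in> {0<..}"
    by (simp add: eventually_at_right_less)
  then show "\<forall>\<^sub>F \<epsilon> in at_right 0. hb_premeasure \<alpha> \<epsilon> \<nu> E < a"
    by eventually_elim (rule le_less_trans[OF SUP_upper a])
qed

lemma hb_measure_eq_SUP: "hb_measure \<alpha> \<nu> E = (SUP \<epsilon>\<in>{0<..}. hb_premeasure \<alpha> \<epsilon> \<nu> E)"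
  unfolding hb_measure_def
  by (rule tendsto_Lim[OF trivial_limit_at_right_real tendsto_hb_premeasure])

definition hb_dim :: "real measure \<Rightarrow> real set \<Rightarrow> ereal" where
  "hb_dim \<nu> E = Inf {ereal \<alpha> | \<alpha>. 0 < \<alpha> \<and> hb_measure \<alpha> \<nu> E = 0}"

definition hb_dim_measure :: "real measure \<Rightarrow> real measure \<Rightarrow> ereal" where
  "hb_dim_measure \<mu> \<nu> = (INF E\<in>{E. E \<in> sets borel \<and> bounded E \<and> measure \<mu> E = 1}. hb_dim \<nu> E)"

end

theory Submission
  imports Defs
begin

text \<open>
  Write the digits of a point in order. Because the sequence of reciprocals is superdecreasing (each
  term exceeds the sum of all later ones), fixing the first \<open>n\<close> digits confines the sum to one of
  \<open>2 ^ n\<close> pairwise disjoint closed intervals, the cylinders of rank \<open>n\<close>. A law with independent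
  digits gives a cylinder the product of its digit probabilities; in particular \<open>\<nu>r\<close> gives each
  cylinder of rank \<open>n\<close> the mass \<open>2 ^ - n\<close>, so that the dimension with respect to \<open>\<nu>r\<close> compares
  everything with the powers of \<open>2 ^ - n\<close>, whatever the metric geometry of the series.

  Two criteria carry the proof. If every point of a set lies in infinitely many cylinders of mass at
  least \<open>2 ^ (- \<alpha> n)\<close> under a digit law, then these heavy cylinders are an efficient cover, because
  those of one rank have total mass at most 1: the dimension is at most \<open>\<alpha>\<close>
  (\<open>hb_dim_le_if_frequently_heavy\<close>). If all cylinders of large rank that meet a set of positive mass
  have mass at most \<open>2 ^ (- \<alpha> n)\<close>, then the mass distribution principle shows that the dimension is
  at least \<open>\<alpha>\<close> (\<open>hb_dim_ge_if_eventually_light\<close>). It applies to covers by arbitrary intervals, since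
  an interval of \<open>\<nu>r\<close>-mass at most \<open>2 ^ - n\<close> meets at most three cylinders of rank \<open>n\<close>: at most two
  contain one of its end points and any other is swallowed whole.

  For the dimension of \<open>\<mu>\<close> it remains to see that the \<open>\<mu>\<close>-mass of the cylinder of rank \<open>n\<close> around a
  typical point is close to \<open>exp (- H n)\<close>. Instead of a law of large numbers, an exponential moment
  bound is used: the words of length \<open>n\<close> for which minus the logarithm of the mass is off \<open>H n\<close> by at
  least \<open>\<delta> n\<close> carry at most mass \<open>exp (- c n)\<close> (\<open>word_prob_deviation\<close>). This is a computation with
  finite sums, in which the moment factors over the digits.

  The spectrum of \<open>\<mu>\<close> consists of the points all of whose cylinders have positive \<open>\<mu>\<close>-mass. It has
  full measure under the law obtained from \<open>\<mu>\<close> by making every genuinely random digit fair, and each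
  cylinder of rank \<open>n\<close> that meets the spectrum has mass \<open>2 ^ - N n\<close> under that law. Both criteria
  then yield the lower density of the random digits.
\<close>

section \<open>Superdecreasing series and their cylinders\<close>

text \<open>The strict domination is what separates the sums of the series that differ in some digit. Signs are
  arbitrary, which covers alternating series.\<close>

locale superdecreasing_series =
  fixes a :: "nat \<Rightarrow> real"
  assumes abs_summable: "summable (\<lambda>k. \<bar>a k\<bar>)"
    and tail_less: "(\<Sum>j. \<bar>a (j + Suc k)\<bar>) < \<bar>a k\<bar>"
begin

text \<open>The least and the greatest contribution of the digits from index \<open>n\<close> onwards are
  \<open>- neg_tail n\<close> and \<open>pos_tail n\<close>: take the digit 1 exactly at the negative, respectively positive, terms.\<close>

definition neg_tail :: "nat \<Rightarrow> real" where
  "neg_tail n = (\<Sum>j. max 0 (- a (j + n)))"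

definition pos_tail :: "nat \<Rightarrow> real" where
  "pos_tail n = (\<Sum>j. max 0 (a (j + n)))"

text \<open>A word of length \<open>n\<close> over the digits 0 and 1 is encoded by the set \<open>W \<subseteq> {..<n}\<close> of the positions
  of its ones; \<open>cyl n W\<close> is the smallest interval containing all sums with this initial word.\<close>

definition cyl :: "nat \<Rightarrow> nat set \<Rightarrow> real set" where
  "cyl n W = {sum a W - neg_tail n .. sum a W + pos_tail n}"

lemma summable_tail: "summable (\<lambda>j. \<bar>a (j + n)\<bar>)"
  using abs_summable by (subst summable_iff_shift[of "\<lambda>k. \<bar>a k\<bar>"])

lemma summable_neg: "summable (\<lambda>j. max 0 (- a (j + n)))"
  by (rule summable_comparison_test'[OF summable_tail[of n], of 0]) auto

lemma summable_pos: "summable (\<lambda>j. max 0 (a (j + n)))"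
  by (rule summable_comparison_test'[OF summable_tail[of n], of 0]) auto

lemma neg_tail_nonneg: "0 \<le> neg_tail n"
  unfolding neg_tail_def by (intro suminf_nonneg summable_neg) auto

lemma pos_tail_nonneg: "0 \<le> pos_tail n"
  unfolding pos_tail_def by (intro suminf_nonneg summable_pos) auto

lemma tail_eq: "neg_tail n + pos_tail n = (\<Sum>j. \<bar>a (j + n)\<bar>)"
proof -
  have "neg_tail n + pos_tail n = (\<Sum>j. max 0 (- a (j + n)) + max 0 (a (j + n)))"
    unfolding neg_tail_def pos_tail_def by (intro suminf_add summable_neg summable_pos)
  also have "\<dots> = (\<Sum>j. \<bar>a (j + n)\<bar>)"
    by (intro suminf_cong) (auto simp: max_def)
  finally show ?thesis .
qed

lemma tail_split:
  assumes "m \<le> n"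
  shows "(\<Sum>j. \<bar>a (j + m)\<bar>) = (\<Sum>k\<in>{m..<n}. \<bar>a k\<bar>) + (\<Sum>j. \<bar>a (j + n)\<bar>)"
proof -
  have "(\<Sum>j. \<bar>a (j + m)\<bar>) = (\<Sum>j. \<bar>a (j + (n - m) + m)\<bar>) + (\<Sum>j<n - m. \<bar>a (j + m)\<bar>)"
    by (rule suminf_split_initial_segment[OF summable_tail])
  moreover have "(\<Sum>j<n - m. \<bar>a (j + m)\<bar>) = (\<Sum>k\<in>{m..<n}. \<bar>a k\<bar>)"
    by (rule sum.reindex_bij_witness[of _ "\<lambda>k. k - m" "\<lambda>j. j + m"]) (use assms in auto)
  ultimately show ?thesis using assms by (simp add: add.assoc)
qed

lemma tail_tendsto_0: "(\<lambda>n. neg_tail n + pos_tail n) \<longlonglongrightarrow> 0"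
proof -
  have "(\<lambda>n. (\<Sum>k. \<bar>a k\<bar>) - (\<Sum>k<n. \<bar>a k\<bar>)) \<longlonglongrightarrow> (\<Sum>k. \<bar>a k\<bar>) - (\<Sum>k. \<bar>a k\<bar>)"
    by (intro tendsto_intros summable_LIMSEQ abs_summable)
  moreover have "(\<Sum>k. \<bar>a k\<bar>) - (\<Sum>k<n. \<bar>a k\<bar>) = neg_tail n + pos_tail n" for n
    unfolding tail_eq using suminf_split_initial_segment[OF abs_summable, of n] by simp
  ultimately show ?thesis by simp
qed

lemma cyl_interval: "cyl n W \<in> {{l..u} | l u. l \<le> u}"
proof -
  have "sum a W - neg_tail n \<le> sum a W + pos_tail n"
    using neg_tail_nonneg[of n] pos_tail_nonneg[of n] by simp
  then show ?thesis unfolding cyl_def by blast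
qed

text \<open>Up to the first index \<open>m\<close> at which the words differ the sums agree, and the term \<open>a m\<close> outweighs
  all terms between \<open>m\<close> and \<open>n\<close> by more than the tail from \<open>n\<close>, which is the length of a cylinder.\<close>

lemma cyl_disjoint:
  assumes W: "W \<subseteq> {..<n}" and V: "V \<subseteq> {..<n}" and ne: "W \<noteq> V"
  shows "cyl n W \<inter> cyl n V = {}"
proof -
  define m where "m = (LEAST k. (k \<in> W) \<noteq> (k \<in> V))"
  obtain k0 where k0: "(k0 \<in> W) \<noteq> (k0 \<in> V)" using ne by auto
  have m: "(m \<in> W) \<noteq> (m \<in> V)" unfolding m_def by (rule LeastI, rule k0)
  have less: "(k \<in> W) = (k \<in> V)" if "k < m" for k
    using not_less_Least[of k "\<lambda>k. (k \<in> W) \<noteq> (k \<in> V)"] that unfolding m_def by blast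
  have mn: "m < n" using m W V by auto
  define d where "d k = (if k \<in> W then a k else 0) - (if k \<in> V then a k else 0)" for k
  have sums: "sum a Z = (\<Sum>k<n. if k \<in> Z then a k else 0)" if "Z \<subseteq> {..<n}" for Z
    using that by (simp add: sum.If_cases Int_absorb1)
  have "sum a W - sum a V = (\<Sum>k<n. d k)"
    unfolding sums[OF W] sums[OF V] d_def by (simp add: sum_subtractf)
  also have "{..<n} = {..<m} \<union> {m..<n}" using mn by auto
  also have "(\<Sum>k\<in>{..<m} \<union> {m..<n}. d k) = (\<Sum>k<m. d k) + (\<Sum>k\<in>{m..<n}. d k)"
    by (rule sum.union_disjoint) auto
  also have "(\<Sum>k<m. d k) = 0" using less by (intro sum.neutral) (auto simp: d_def)
  also have "(\<Sum>k\<in>{m..<n}. d k) = d m + (\<Sum>k\<in>{Suc m..<n}. d k)"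
    using mn by (rule sum.atLeast_Suc_lessThan)
  finally have diff: "sum a W - sum a V = d m + (\<Sum>k\<in>{Suc m..<n}. d k)" by simp
  have "\<bar>\<Sum>k\<in>{Suc m..<n}. d k\<bar> \<le> (\<Sum>k\<in>{Suc m..<n}. \<bar>d k\<bar>)" by (rule sum_abs)
  also have "\<dots> \<le> (\<Sum>k\<in>{Suc m..<n}. \<bar>a k\<bar>)"
    by (rule sum_mono) (auto simp: d_def)
  also have "\<dots> = (\<Sum>j. \<bar>a (j + Suc m)\<bar>) - (neg_tail n + pos_tail n)"
    using tail_split[of "Suc m" n] mn by (simp add: tail_eq)
  also have "\<dots> < \<bar>a m\<bar> - (neg_tail n + pos_tail n)"
    using tail_less[of m] by simp
  finally have "\<bar>\<Sum>k\<in>{Suc m..<n}. d k\<bar> < \<bar>d m\<bar> - (neg_tail n + pos_tail n)"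
    using m by (auto simp: d_def)
  then have far: "\<bar>sum a W - sum a V\<bar> > neg_tail n + pos_tail n" unfolding diff by linarith
  show ?thesis
  proof (rule equals0I)
    fix x assume "x \<in> cyl n W \<inter> cyl n V"
    then show False using far by (auto simp: cyl_def)
  qed
qed

text \<open>This bounds the number of cylinders that an interval meets without containing them: disjointness
  leaves at most one for each end point.\<close>

lemma cyl_met_by_interval:
  assumes "cyl n W \<inter> {l..u} \<noteq> {}"
  shows "cyl n W \<subseteq> {l..u} \<or> l \<in> cyl n W \<or> u \<in> cyl n W"
  using assms by (auto simp: cyl_def)

lemma cyl_measurable [measurable]: "cyl n W \<in> sets borel"
  by (simp add: cyl_def)

lemma closed_cyl: "closed (cyl n W)"
  by (simp add: cyl_def)

lemma series_in_cyl:
  fixes x :: "nat \<Rightarrow> real"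
  assumes x: "\<And>k. x k = 0 \<or> x k = 1"
  shows "(\<Sum>k. a k * x k) \<in> cyl n {k. k < n \<and> x k = 1}"
proof -
  have le: "\<bar>a k * x k\<bar> \<le> \<bar>a k\<bar>" for k using x[of k] by auto
  have s: "summable (\<lambda>k. a k * x k)"
    by (rule summable_comparison_test'[OF abs_summable, of 0]) (use le in auto)
  then have sn: "summable (\<lambda>k. a (k + n) * x (k + n))"
    by (subst summable_iff_shift[of "\<lambda>k. a k * x k"])
  have "(\<Sum>k. a k * x k) = (\<Sum>k. a (k + n) * x (k + n)) + (\<Sum>k<n. a k * x k)"
    by (rule suminf_split_initial_segment[OF s])
  moreover have "(\<Sum>k<n. a k * x k) = sum a {k. k < n \<and> x k = 1}"
  proof -
    have "(\<Sum>k<n. a k * x k) = (\<Sum>k<n. if x k = 1 then a k else 0)"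
      by (intro sum.cong refl) (use x in force)
    also have "\<dots> = sum a {k. k < n \<and> x k = 1}"
      by (simp add: sum.If_cases Int_def)
    finally show ?thesis .
  qed
  moreover have "(\<Sum>k. a (k + n) * x (k + n)) \<le> pos_tail n"
    unfolding pos_tail_def
  proof (intro suminf_le sn summable_pos)
    show "a (k + n) * x (k + n) \<le> max 0 (a (k + n))" for k using x[of "k + n"] by auto
  qed
  moreover have "- (\<Sum>k. a (k + n) * x (k + n)) \<le> neg_tail n"
    unfolding neg_tail_def suminf_minus[OF sn, symmetric]
  proof (intro suminf_le summable_neg)
    show "- (a (k + n) * x (k + n)) \<le> max 0 (- a (k + n))" for k using x[of "k + n"] by auto
    show "summable (\<lambda>k. - (a (k + n) * x (k + n)))" using sn by (rule summable_minus)
  qed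
  ultimately show ?thesis by (simp add: cyl_def)
qed

end

section \<open>Entropy and the probabilities of words\<close>

definition word_prob :: "(nat \<Rightarrow> real) \<Rightarrow> nat \<Rightarrow> nat set \<Rightarrow> real" where
  "word_prob p n W = (\<Prod>k\<in>W. p k) * (\<Prod>k\<in>{..<n} - W. 1 - p k)"

lemma word_prob_eq_prod:
  assumes "W \<subseteq> {..<n}"
  shows "word_prob p n W = (\<Prod>k<n. if k \<in> W then p k else 1 - p k)"
  using assms by (simp add: word_prob_def prod.If_cases Int_absorb1 Diff_eq)

definition bit_entropy :: "real \<Rightarrow> real" where
  "bit_entropy x = - (x * ln x + (1 - x) * ln (1 - x))"

lemma sum_word_prob: "(\<Sum>W\<in>Pow {..<n}. word_prob p n W) = 1"
  using prod_add[of "{..<n}" p "\<lambda>k. 1 - p k"] by (simp add: word_prob_def)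

lemma word_prob_nonneg:
  assumes "\<And>k. 0 \<le> p k \<and> p k \<le> 1"
  shows "0 \<le> word_prob p n W"
  unfolding word_prob_def by (intro mult_nonneg_nonneg prod_nonneg) (use assms in auto)

lemma minus_mult_ln_le: "- (x * ln x) \<le> 1 - x" if "0 \<le> x" for x :: real
proof (cases "x = 0")
  case False
  then have "x * (- ln x) \<le> x * (1 / x - 1)"
    using that ln_le_minus_one[of "1 / x"] by (intro mult_left_mono) (auto simp: ln_div)
  then show ?thesis using False by (simp add: right_diff_distrib)
qed auto

lemma bit_entropy_bounds:
  assumes "0 \<le> x" "x \<le> 1"
  shows "0 \<le> bit_entropy x" "bit_entropy x \<le> 1"
proof -
  have neg: "y * ln y \<le> 0" if "0 \<le> y" "y \<le> 1" for y :: real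
    using that by (cases "y = 0") (auto intro: mult_nonneg_nonpos)
  show "0 \<le> bit_entropy x" using neg[of x] neg[of "1 - x"] assms by (simp add: bit_entropy_def)
  show "bit_entropy x \<le> 1"
    using minus_mult_ln_le[of x] minus_mult_ln_le[of "1 - x"] assms by (simp add: bit_entropy_def)
qed

lemma exp_le_quadratic: "exp y \<le> 1 + y + y\<^sup>2 * exp \<bar>y\<bar>" for y :: real
proof -
  have "exp y * (1 - y) \<le> exp y * exp (- y)"
    using exp_ge_add_one_self[of "- y"] by (intro mult_left_mono) auto
  then have 1: "exp y \<le> 1 + y * exp y" by (simp add: exp_minus field_simps)
  have "y * (exp y - 1) \<le> y * (y * exp \<bar>y\<bar>)"
  proof (cases "y \<ge> 0")
    case True
    then show ?thesis using 1 by (intro mult_left_mono) auto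
  next
    case False
    have "y * exp \<bar>y\<bar> \<le> y * 1" using False by (intro mult_left_mono_neg) auto
    also have "\<dots> \<le> exp y - 1" using exp_ge_add_one_self[of y] by linarith
    finally show ?thesis using False by (intro mult_left_mono_neg) auto
  qed
  with 1 show ?thesis by (simp add: power2_eq_square algebra_simps)
qed

text \<open>A digit of probability \<open>x\<close> contributes \<open>- ln x\<close>, which is unbounded, to the information content of a
  word; but the factor \<open>x\<close> tames the exponential of a quarter of it. Hence the error of the first order
  expansion in \<open>s\<close> is quadratic with a constant that does not depend on \<open>x\<close>.\<close>

lemma tilted_weight_le:
  fixes x s h :: real
  assumes x: "0 \<le> x" "x \<le> 1" and h: "0 \<le> h" "h \<le> 1" and s: "\<bar>s\<bar> \<le> 1 / 4"
  shows "x * exp (s * (- ln x - h)) \<le> x + s * (- (x * ln x) - x * h) + 16 * exp (3 / 4) * s\<^sup>2"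
proof (cases "x = 0")
  case False
  define u where "u = - ln x"
  have u: "0 \<le> u" using x False by (simp add: u_def)
  have xu: "x = exp (- u)" using x False by (simp add: u_def)
  define y where "y = s * (u - h)"
  have "\<bar>y\<bar> = \<bar>s\<bar> * \<bar>u - h\<bar>" by (simp add: y_def abs_mult)
  also have "\<dots> \<le> \<bar>s\<bar> * (u + 1)" using u h by (intro mult_left_mono) auto
  finally have y1: "\<bar>y\<bar> \<le> \<bar>s\<bar> * (u + 1)" .
  also have "\<dots> \<le> 1 / 4 * (u + 1)" using s u by (intro mult_right_mono) auto
  finally have y2: "\<bar>y\<bar> \<le> (u + 1) / 4" by simp
  have y3: "y\<^sup>2 \<le> s\<^sup>2 * (u + 1)\<^sup>2"
    using power_mono[OF y1, of 2] by (simp add: power_mult_distrib)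
  \<comment> \<open>three quarters of the available decay \<open>x = exp (- u)\<close> are spent: one half on \<open>(u + 1)\<^sup>2\<close>,
    one quarter on \<open>exp \<bar>y\<bar>\<close>\<close>
  have "(u + 1) / 4 \<le> exp ((u + 1) / 4)" using exp_ge_add_one_self[of "(u + 1) / 4"] by linarith
  then have "((u + 1) / 4)\<^sup>2 \<le> (exp ((u + 1) / 4))\<^sup>2" using u by (intro power_mono) auto
  then have u2: "(u + 1)\<^sup>2 \<le> 16 * exp ((u + 1) / 2)"
    by (simp add: power_divide power2_eq_square flip: exp_add)
  have "x * (y\<^sup>2 * exp \<bar>y\<bar>) \<le> x * ((s\<^sup>2 * (16 * exp ((u + 1) / 2))) * exp ((u + 1) / 4))"
    using x y2 by (intro mult_left_mono mult_mono order_trans[OF y3] u2) auto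
  also have "\<dots> = 16 * s\<^sup>2 * exp (- u + ((u + 1) / 2 + (u + 1) / 4))"
    unfolding xu exp_add by simp
  also have "\<dots> \<le> 16 * s\<^sup>2 * exp (3 / 4)"
    using u by (intro mult_left_mono) (auto simp: field_simps)
  finally have r: "x * (y\<^sup>2 * exp \<bar>y\<bar>) \<le> 16 * exp (3 / 4) * s\<^sup>2" by (simp add: mult_ac)
  have "x * exp y \<le> x * (1 + y + y\<^sup>2 * exp \<bar>y\<bar>)"
    using x by (intro mult_left_mono exp_le_quadratic) auto
  also have "\<dots> \<le> x + x * y + 16 * exp (3 / 4) * s\<^sup>2" using r by (simp add: algebra_simps)
  finally show ?thesis by (simp add: y_def u_def algebra_simps)
qed auto

text \<open>The moment is a product over the digits by the distributive law. In each factor the terms linear in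
  \<open>s\<close> cancel, since the entropy is the mean of the information content.\<close>

lemma exponential_moment_word_prob:
  assumes p: "\<And>k. 0 \<le> p k \<and> p k \<le> 1" and s: "\<bar>s\<bar> \<le> 1 / 4"
  shows "(\<Sum>W\<in>Pow {..<n}. word_prob p n W *
           exp (s * (- ln (word_prob p n W) - (\<Sum>k<n. bit_entropy (p k)))))
         \<le> exp (32 * exp (3 / 4) * s\<^sup>2 * n)"
proof -
  define g where "g x k = x * exp (s * (- ln x - bit_entropy (p k)))" for x k
  have "word_prob p n W * exp (s * (- ln (word_prob p n W) - (\<Sum>k<n. bit_entropy (p k))))
      = (\<Prod>k\<in>W. g (p k) k) * (\<Prod>k\<in>{..<n} - W. g (1 - p k) k)" if W: "W \<in> Pow {..<n}" for W
  proof -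
    define b where "b k = (if k \<in> W then p k else 1 - p k)" for k
    have split: "(\<Prod>k\<in>W. f1 k) * (\<Prod>k\<in>{..<n} - W. f2 k) = (\<Prod>k<n. if k \<in> W then f1 k else f2 k)"
      for f1 f2 :: "nat \<Rightarrow> real"
      using W by (simp add: prod.If_cases Int_absorb1 Diff_eq)
    have wb: "word_prob p n W = (\<Prod>k<n. b k)"
      unfolding word_prob_def split b_def ..
    have gb: "(\<Prod>k\<in>W. g (p k) k) * (\<Prod>k\<in>{..<n} - W. g (1 - p k) k) = (\<Prod>k<n. g (b k) k)"
      unfolding split b_def by (intro prod.cong) auto
    show ?thesis
    proof (cases "\<exists>k<n. b k = 0")
      case True
      \<comment> \<open>here \<open>ln 0 = 0\<close> lets the exponential of the sum differ from the product of exponentials,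
        but both are multiplied by 0\<close>
      then have z: "(\<Prod>k<n. b k) = 0" "(\<Prod>k<n. g (b k) k) = 0" by (auto simp: g_def)
      show ?thesis unfolding wb gb z by simp
    next
      case False
      then have pos: "0 < b k" if "k < n" for k
        using that p[of k] unfolding b_def by (auto simp: less_le)
      have "ln (\<Prod>k<n. b k) = (\<Sum>k<n. ln (b k))"
        using False by (intro ln_prod) auto
      then have "s * (- ln (\<Prod>k<n. b k) - (\<Sum>k<n. bit_entropy (p k)))
        = (\<Sum>k<n. s * (- ln (b k) - bit_entropy (p k)))"
        by (simp add: sum_distrib_left sum_subtractf sum_negf right_diff_distrib)
      then show ?thesis
        unfolding wb gb by (simp add: g_def exp_sum prod.distrib)
    qed
  qed
  then have "(\<Sum>W\<in>Pow {..<n}. word_prob p n W *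
           exp (s * (- ln (word_prob p n W) - (\<Sum>k<n. bit_entropy (p k)))))
      = (\<Prod>k<n. g (p k) k + g (1 - p k) k)"
    using prod_add[of "{..<n}" "\<lambda>k. g (p k) k" "\<lambda>k. g (1 - p k) k"] by simp
  also have "\<dots> \<le> (\<Prod>k<n. exp (32 * exp (3 / 4) * s\<^sup>2))"
  proof (intro prod_mono conjI)
    fix k
    show "0 \<le> g (p k) k + g (1 - p k) k" using p[of k] by (simp add: g_def)
    have h: "0 \<le> bit_entropy (p k)" "bit_entropy (p k) \<le> 1"
      using bit_entropy_bounds[of "p k"] p[of k] by auto
    have "g (p k) k \<le> p k + s * (- (p k * ln (p k)) - p k * bit_entropy (p k)) + 16 * exp (3 / 4) * s\<^sup>2"
      unfolding g_def using p[of k] h s by (intro tilted_weight_le) auto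
    moreover have "g (1 - p k) k \<le> (1 - p k)
        + s * (- ((1 - p k) * ln (1 - p k)) - (1 - p k) * bit_entropy (p k)) + 16 * exp (3 / 4) * s\<^sup>2"
      unfolding g_def using p[of k] h s by (intro tilted_weight_le) auto
    moreover have "p k + s * (- (p k * ln (p k)) - p k * bit_entropy (p k)) + ((1 - p k)
        + s * (- ((1 - p k) * ln (1 - p k)) - (1 - p k) * bit_entropy (p k))) = 1"
      by (simp add: bit_entropy_def algebra_simps)
    ultimately have "g (p k) k + g (1 - p k) k \<le> 1 + 32 * exp (3 / 4) * s\<^sup>2" by linarith
    also have "\<dots> \<le> exp (32 * exp (3 / 4) * s\<^sup>2)" by (rule exp_ge_add_one_self)
    finally show "g (p k) k + g (1 - p k) k \<le> exp (32 * exp (3 / 4) * s\<^sup>2)" .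
  qed
  also have "\<dots> = exp (32 * exp (3 / 4) * s\<^sup>2 * n)"
    by (simp add: exp_of_nat_mult[symmetric] mult_ac)
  finally show ?thesis .
qed

text \<open>Markov's inequality for the exponential moment. The sign \<open>\<sigma>\<close> selects the upper or the lower tail.\<close>

lemma word_prob_deviation:
  assumes p: "\<And>k. 0 \<le> p k \<and> p k \<le> 1" and d: "0 < \<delta>"
  shows "\<exists>c>0. \<forall>n. \<forall>\<sigma>. \<bar>\<sigma>\<bar> = 1 \<longrightarrow>
      (\<Sum>W\<in>{W \<in> Pow {..<n}. n * \<delta> \<le> \<sigma> * (- ln (word_prob p n W) - (\<Sum>k<n. bit_entropy (p k)))}.
        word_prob p n W) \<le> exp (- c * n)"
proof -
  define C :: real where "C = 32 * exp (3 / 4)"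
  have C: "0 < C" by (simp add: C_def)
  \<comment> \<open>the exponent \<open>C * t\<^sup>2 - t * \<delta>\<close> is at most \<open>- t * \<delta> / 2\<close> for this \<open>t\<close>\<close>
  define t where "t = min (1 / 4) (\<delta> / (2 * C))"
  have t: "0 < t" "t \<le> 1 / 4" "t \<le> \<delta> / (2 * C)" using d C by (auto simp: t_def)
  have c_pos: "0 < t * \<delta> / 2" using t d by simp
  have "(\<Sum>W\<in>{W \<in> Pow {..<n}. n * \<delta> \<le> \<sigma> * (- ln (word_prob p n W)
      - (\<Sum>k<n. bit_entropy (p k)))}. word_prob p n W) \<le> exp (- (t * \<delta> / 2) * n)"
    if sig: "\<bar>\<sigma>\<bar> = 1" for n :: nat and \<sigma> :: real
  proof -
  define L where "L W = - ln (word_prob p n W) - (\<Sum>k<n. bit_entropy (p k))" for W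
  have "C * t \<le> \<delta> / 2" using t(3) C by (simp add: field_simps)
  then have Ct: "C * t\<^sup>2 \<le> t * \<delta> / 2"
    using mult_left_mono[of "C * t" "\<delta> / 2" t] t(1) by (simp add: power2_eq_square mult_ac)
  have "(\<Sum>W\<in>{W \<in> Pow {..<n}. n * \<delta> \<le> \<sigma> * L W}. word_prob p n W)
      \<le> (\<Sum>W\<in>{W \<in> Pow {..<n}. n * \<delta> \<le> \<sigma> * L W}. word_prob p n W * exp ((t * \<sigma>) * L W - t * (n * \<delta>)))"
  proof (rule sum_mono)
    fix W assume "W \<in> {W \<in> Pow {..<n}. n * \<delta> \<le> \<sigma> * L W}"
    then have "t * (n * \<delta>) \<le> t * (\<sigma> * L W)" using t by (intro mult_left_mono) auto
    then have "1 \<le> exp ((t * \<sigma>) * L W - t * (n * \<delta>))" by (simp add: mult_ac)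
    then have "word_prob p n W * 1 \<le> word_prob p n W * exp ((t * \<sigma>) * L W - t * (n * \<delta>))"
      by (intro mult_left_mono word_prob_nonneg p)
    then show "word_prob p n W \<le> word_prob p n W * exp ((t * \<sigma>) * L W - t * (n * \<delta>))"
      by simp
  qed
  also have "\<dots> \<le> (\<Sum>W\<in>Pow {..<n}. word_prob p n W * exp ((t * \<sigma>) * L W - t * (n * \<delta>)))"
    by (intro sum_mono2) (auto intro: mult_nonneg_nonneg word_prob_nonneg[OF p])
  also have "\<dots> = (\<Sum>W\<in>Pow {..<n}. word_prob p n W * exp ((t * \<sigma>) * L W)) * exp (- (t * (n * \<delta>)))"
    unfolding sum_distrib_right
    by (intro sum.cong) (auto simp: exp_diff exp_minus divide_inverse mult.assoc)
  also have "\<dots> \<le> exp (C * (t * \<sigma>)\<^sup>2 * n) * exp (- (t * (n * \<delta>)))"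
    unfolding L_def C_def using t sig
    by (intro mult_right_mono exponential_moment_word_prob p) (auto simp: abs_mult)
  also have "(t * \<sigma>)\<^sup>2 = t\<^sup>2"
    using sig by (metis abs_mult mult.right_neutral power2_abs)
  also have "exp (C * t\<^sup>2 * n) * exp (- (t * (n * \<delta>))) = exp (C * t\<^sup>2 * n - t * \<delta> * n)"
    by (simp add: exp_add[symmetric] mult_ac)
  also have "\<dots> \<le> exp (- (t * \<delta> / 2) * n)"
    using mult_right_mono[OF Ct, of "real n"] by (simp add: algebra_simps)
  finally show ?thesis unfolding L_def .
  qed
  with c_pos show ?thesis by (intro exI[of _ "t * \<delta> / 2"]) blast
qed

text \<open>At a length at which the mean entropy per digit is at most \<open>\<alpha>'\<close> bits, words lighter than
  \<open>2 powr (- \<alpha> * n)\<close> carry far more information than expected.\<close>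

lemma light_words_improbable:
  assumes p: "\<And>k. 0 \<le> p k \<and> p k \<le> 1" and "\<alpha>' < \<alpha>"
  shows "\<exists>c>0. \<forall>n. (\<Sum>k<n. bit_entropy (p k)) \<le> \<alpha>' * n * ln 2 \<longrightarrow>
      (\<Sum>W\<in>{W \<in> Pow {..<n}. word_prob p n W < 2 powr (- \<alpha> * n)}. word_prob p n W) \<le> exp (- c * n)"
proof -
  have "0 < (\<alpha> - \<alpha>') * ln 2" using assms by simp
  from word_prob_deviation[of p, OF p this] obtain c where c: "0 < c" and
    dev: "\<forall>n. \<forall>\<sigma>. \<bar>\<sigma>\<bar> = 1 \<longrightarrow> (\<Sum>W\<in>{W \<in> Pow {..<n}. n * ((\<alpha> - \<alpha>') * ln 2)
        \<le> \<sigma> * (- ln (word_prob p n W) - (\<Sum>k<n. bit_entropy (p k)))}. word_prob p n W) \<le> exp (- c * n)"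
    by (elim exE conjE)
  have "(\<Sum>W\<in>{W \<in> Pow {..<n}. word_prob p n W < 2 powr (- \<alpha> * n)}. word_prob p n W) \<le> exp (- c * n)"
    if H: "(\<Sum>k<n. bit_entropy (p k)) \<le> \<alpha>' * n * ln 2" for n :: nat
  proof -
    let ?S = "{W \<in> Pow {..<n}. word_prob p n W < 2 powr (- \<alpha> * n)}"
    let ?T = "{W \<in> Pow {..<n}. n * ((\<alpha> - \<alpha>') * ln 2)
        \<le> 1 * (- ln (word_prob p n W) - (\<Sum>k<n. bit_entropy (p k)))}"
    \<comment> \<open>null words must go first: \<open>ln 0 = 0\<close> hides that their information content is infinite\<close>
    have "(\<Sum>W\<in>?S. word_prob p n W) = (\<Sum>W\<in>{W \<in> ?S. word_prob p n W \<noteq> 0}. word_prob p n W)"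
      by (rule sum.mono_neutral_right) auto
    also have "\<dots> \<le> (\<Sum>W\<in>?T. word_prob p n W)"
    proof (rule sum_mono2)
      show "{W \<in> ?S. word_prob p n W \<noteq> 0} \<subseteq> ?T"
      proof (intro subsetI CollectI conjI)
        fix W assume W: "W \<in> {W \<in> ?S. word_prob p n W \<noteq> 0}"
        then show "W \<in> Pow {..<n}" by simp
        have "0 < word_prob p n W" using W word_prob_nonneg[of p n W, OF p] by (simp add: less_le)
        then have "ln (word_prob p n W) < ln (2 powr (- \<alpha> * n))"
          using W by (intro ln_less_cancel_iff[THEN iffD2]) auto
        then have "\<alpha> * n * ln 2 < - ln (word_prob p n W)" by (simp add: ln_powr)
        with H have "\<alpha> * n * ln 2 - \<alpha>' * n * ln 2
            \<le> - ln (word_prob p n W) - (\<Sum>k<n. bit_entropy (p k))" by linarith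
        then show "n * ((\<alpha> - \<alpha>') * ln 2) \<le> 1 * (- ln (word_prob p n W) - (\<Sum>k<n. bit_entropy (p k)))"
          by (simp add: algebra_simps)
      qed
    qed (auto intro: word_prob_nonneg[of p, OF p])
    also have "\<dots> \<le> exp (- c * n)" using dev[rule_format, of 1 n] by simp
    finally show ?thesis .
  qed
  with c show ?thesis by (intro exI[of _ c]) simp
qed

lemma heavy_words_improbable:
  assumes p: "\<And>k. 0 \<le> p k \<and> p k \<le> 1" and "\<alpha> < \<alpha>'"
  shows "\<exists>c>0. \<forall>n. \<alpha>' * n * ln 2 \<le> (\<Sum>k<n. bit_entropy (p k)) \<longrightarrow>
      (\<Sum>W\<in>{W \<in> Pow {..<n}. 2 powr (- \<alpha> * n) < word_prob p n W}. word_prob p n W) \<le> exp (- c * n)"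
proof -
  have "0 < (\<alpha>' - \<alpha>) * ln 2" using assms by simp
  from word_prob_deviation[of p, OF p this] obtain c where c: "0 < c" and
    dev: "\<forall>n. \<forall>\<sigma>. \<bar>\<sigma>\<bar> = 1 \<longrightarrow> (\<Sum>W\<in>{W \<in> Pow {..<n}. n * ((\<alpha>' - \<alpha>) * ln 2)
        \<le> \<sigma> * (- ln (word_prob p n W) - (\<Sum>k<n. bit_entropy (p k)))}. word_prob p n W) \<le> exp (- c * n)"
    by (elim exE conjE)
  have "(\<Sum>W\<in>{W \<in> Pow {..<n}. 2 powr (- \<alpha> * n) < word_prob p n W}. word_prob p n W) \<le> exp (- c * n)"
    if H: "\<alpha>' * n * ln 2 \<le> (\<Sum>k<n. bit_entropy (p k))" for n :: nat
  proof -
    let ?S = "{W \<in> Pow {..<n}. 2 powr (- \<alpha> * n) < word_prob p n W}"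
    let ?T = "{W \<in> Pow {..<n}. n * ((\<alpha>' - \<alpha>) * ln 2)
        \<le> - 1 * (- ln (word_prob p n W) - (\<Sum>k<n. bit_entropy (p k)))}"
    have "(\<Sum>W\<in>?S. word_prob p n W) \<le> (\<Sum>W\<in>?T. word_prob p n W)"
    proof (rule sum_mono2)
      show "?S \<subseteq> ?T"
      proof (intro subsetI CollectI conjI)
        fix W assume W: "W \<in> ?S"
        then show "W \<in> Pow {..<n}" by simp
        have heavy: "2 powr (- \<alpha> * n) < word_prob p n W" using W by simp
        have "0 < word_prob p n W" by (rule less_trans[OF _ heavy]) simp
        then have "ln (2 powr (- \<alpha> * n)) < ln (word_prob p n W)"
          using heavy by (intro ln_less_cancel_iff[THEN iffD2]) auto
        then have "- ln (word_prob p n W) < \<alpha> * n * ln 2" by (simp add: ln_powr)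
        with H have "\<alpha>' * n * ln 2 - \<alpha> * n * ln 2
            \<le> (\<Sum>k<n. bit_entropy (p k)) + ln (word_prob p n W)" by linarith
        then show "n * ((\<alpha>' - \<alpha>) * ln 2) \<le> - 1 * (- ln (word_prob p n W) - (\<Sum>k<n. bit_entropy (p k)))"
          by (simp add: algebra_simps)
      qed
    qed (auto intro: word_prob_nonneg[of p, OF p])
    also have "\<dots> \<le> exp (- c * n)" using dev[rule_format, of "- 1" n] by simp
    finally show ?thesis .
  qed
  with c show ?thesis by (intro exI[of _ c]) simp
qed

section \<open>Series with independent random digits\<close>

context superdecreasing_series
begin

text \<open>All that the dimension arguments need to know about the distribution of a series with independent
  random digits, where \<open>p k\<close> is the probability that digit \<open>k\<close> is 1.\<close>

definition digit_law :: "(nat \<Rightarrow> real) \<Rightarrow> real measure \<Rightarrow> bool" where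
  "digit_law p \<rho> \<longleftrightarrow> prob_space \<rho> \<and> sets \<rho> = sets borel \<and> (\<forall>k. 0 \<le> p k \<and> p k \<le> 1) \<and>
     (\<forall>n. \<forall>W\<subseteq>{..<n}. measure \<rho> (cyl n W) = word_prob p n W)"

text \<open>Almost surely all digits are 0 or 1, and then, by disjointness, the sum lies in a cylinder exactly
  if its initial digits spell the word of the cylinder. The shift by \<open>Suc\<close> serves series whose digits
  are indexed from 1.\<close>

lemma digit_law_distr:
  assumes M: "prob_space M" and indep: "prob_space.indep_vars M (\<lambda>_. borel) X {1..}"
    and X1: "\<And>k. \<P>(\<omega> in M. X (Suc k) \<omega> = 1) = p k"
    and X0: "\<And>k. \<P>(\<omega> in M. X (Suc k) \<omega> = 0) = 1 - p k"
  shows "digit_law p (distr M borel (\<lambda>\<omega>. \<Sum>k. a k * X (Suc k) \<omega>))"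
proof -
  interpret prob_space M by fact
  have X_meas [measurable]: "X (Suc k) \<in> borel_measurable M" for k
    using indep by (auto simp: indep_vars_def2)
  define \<phi> where "\<phi> = (\<lambda>\<omega>. \<Sum>k. a k * X (Suc k) \<omega>)"
  have \<phi>_meas [measurable]: "\<phi> \<in> borel_measurable M"
    unfolding \<phi>_def by measurable
  have digits: "AE \<omega> in M. \<forall>k. X (Suc k) \<omega> = 0 \<or> X (Suc k) \<omega> = 1"
  proof (subst AE_all_countable, rule allI)
    fix k
    have "prob {\<omega> \<in> space M. X (Suc k) \<omega> = 0 \<or> X (Suc k) \<omega> = 1}
        = prob ({\<omega> \<in> space M. X (Suc k) \<omega> = 0} \<union> {\<omega> \<in> space M. X (Suc k) \<omega> = 1})"
      by (rule arg_cong[of _ _ prob]) auto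
    also have "\<dots> = prob {\<omega> \<in> space M. X (Suc k) \<omega> = 0} + prob {\<omega> \<in> space M. X (Suc k) \<omega> = 1}"
      by (rule finite_measure_Union) auto
    also have "\<dots> = 1" by (simp add: X0 X1)
    finally show "AE \<omega> in M. X (Suc k) \<omega> = 0 \<or> X (Suc k) \<omega> = 1"
      by (subst (asm) prob_Collect_eq_1) auto
  qed
  have cyl: "measure (distr M borel \<phi>) (cyl n W) = word_prob p n W" if W: "W \<subseteq> {..<n}" for n W
  proof -
    define d :: "nat \<Rightarrow> real" where "d k = (if k \<in> W then 1 else 0)" for k
    have "measure (distr M borel \<phi>) (cyl n W) = prob {\<omega> \<in> space M. \<phi> \<omega> \<in> cyl n W}"
      by (subst measure_distr) (auto intro!: arg_cong[of _ _ prob])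
    also have "\<dots> = prob {\<omega> \<in> space M. \<forall>k<n. X (Suc k) \<omega> = d k}"
    proof (rule measure_eq_AE)
      show "AE \<omega> in M. \<omega> \<in> {\<omega> \<in> space M. \<phi> \<omega> \<in> cyl n W}
          \<longleftrightarrow> \<omega> \<in> {\<omega> \<in> space M. \<forall>k<n. X (Suc k) \<omega> = d k}"
        using digits
      proof eventually_elim
        case (elim \<omega>)
        define D where "D = {k. k < n \<and> X (Suc k) \<omega> = 1}"
        have "\<phi> \<omega> \<in> cyl n D"
          unfolding \<phi>_def D_def by (rule series_in_cyl) (use elim in auto)
        moreover have "D \<subseteq> {..<n}" by (auto simp: D_def)
        ultimately have "\<phi> \<omega> \<in> cyl n W \<longleftrightarrow> D = W"
          using cyl_disjoint[OF _ W, of D] by auto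
        also have "\<dots> \<longleftrightarrow> (\<forall>k<n. X (Suc k) \<omega> = d k)"
        proof
          assume "D = W"
          then show "\<forall>k<n. X (Suc k) \<omega> = d k" using elim by (auto simp: D_def d_def)
        next
          assume "\<forall>k<n. X (Suc k) \<omega> = d k"
          then show "D = W" using W by (fastforce simp: D_def d_def split: if_splits)
        qed
        finally show ?case by simp
      qed
    qed measurable
    also have "\<dots> = (\<Prod>k<n. prob {\<omega> \<in> space M. X (Suc k) \<omega> = d k})"
    proof (cases "n = 0")
      case True
      then show ?thesis by (simp add: prob_space)
    next
      case False
      have "prob (\<Inter>i\<in>Suc ` {..<n}. X i -` {d (i - 1)} \<inter> space M)
          = (\<Prod>i\<in>Suc ` {..<n}. prob (X i -` {d (i - 1)} \<inter> space M))"
        by (rule indep_varsD_finite[OF indep_vars_subset[OF indep]]) (use False in auto)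
      moreover have "(\<Inter>i\<in>Suc ` {..<n}. X i -` {d (i - 1)} \<inter> space M)
          = {\<omega> \<in> space M. \<forall>k<n. X (Suc k) \<omega> = d k}"
        using False by auto
      moreover have "X (Suc k) -` {d k} \<inter> space M = {\<omega> \<in> space M. X (Suc k) \<omega> = d k}" for k
        by auto
      ultimately show ?thesis by (simp add: prod.reindex)
    qed
    also have "\<dots> = (\<Prod>k<n. if k \<in> W then p k else 1 - p k)"
      by (intro prod.cong) (auto simp: d_def X0 X1)
    also have "\<dots> = word_prob p n W"
      by (rule word_prob_eq_prod[OF W, symmetric])
    finally show ?thesis .
  qed
  have "0 \<le> p k \<and> p k \<le> 1" for k
    using X0[of k] X1[of k] by (metis diff_ge_0_iff_ge measure_nonneg)
  then show ?thesis
    using cyl unfolding digit_law_def \<phi>_def[symmetric] by (auto intro!: prob_space_distr)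
qed

lemma digit_lawD:
  assumes "digit_law p \<rho>"
  shows "prob_space \<rho>" "sets \<rho> = sets borel" "\<And>k. 0 \<le> p k \<and> p k \<le> 1"
    "\<And>n W. W \<subseteq> {..<n} \<Longrightarrow> measure \<rho> (cyl n W) = word_prob p n W"
  using assms unfolding digit_law_def by auto

lemma measure_UN_cyl:
  assumes \<rho>: "digit_law p \<rho>" and S: "S \<subseteq> Pow {..<n}"
  shows "measure \<rho> (\<Union>W\<in>S. cyl n W) = (\<Sum>W\<in>S. word_prob p n W)"
proof -
  interpret prob_space \<rho> using \<rho> by (rule digit_lawD)
  have [simp]: "sets \<rho> = sets borel" using \<rho> by (rule digit_lawD)
  have "finite S" using S by (rule finite_subset) simp
  moreover have "disjoint_family_on (cyl n) S"
    using cyl_disjoint S unfolding disjoint_family_on_def by blast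
  ultimately have "measure \<rho> (\<Union>W\<in>S. cyl n W) = (\<Sum>W\<in>S. measure \<rho> (cyl n W))"
    by (intro finite_measure_finite_Union) auto
  also have "\<dots> = (\<Sum>W\<in>S. word_prob p n W)"
    using S by (intro sum.cong digit_lawD[OF \<rho>]) auto
  finally show ?thesis .
qed

lemma measure_all_cyl:
  assumes "digit_law p \<rho>"
  shows "measure \<rho> (\<Union>W\<in>Pow {..<n}. cyl n W) = 1"
  using measure_UN_cyl[OF assms order_refl, of n] by (simp add: sum_word_prob)

end

section \<open>Cylinder criteria for the Hausdorff--Billingsley dimension\<close>

lemma word_prob_half:
  assumes "W \<subseteq> {..<n}"
  shows "word_prob (\<lambda>_. 1 / 2) n W = (1 / 2) ^ n"
proof -
  have "card W + card ({..<n} - W) = n"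
    using assms by (metis card_lessThan card_Diff_subset card_mono finite_lessThan finite_subset le_add_diff_inverse)
  then show ?thesis by (simp add: word_prob_def flip: power_add)
qed

lemma half_power_eq_powr: "(1 / 2 :: real) ^ n = 2 powr (- real n)"
  by (simp add: powr_minus powr_realpow power_one_over inverse_eq_divide)

lemma half_power_powr: "((1 / 2 :: real) ^ n) powr \<beta> = 2 powr (- \<beta> * real n)"
  by (simp add: half_power_eq_powr powr_powr mult.commute)

lemma hb_dim_leI:
  assumes "0 \<le> \<alpha>" and "\<And>\<beta>. \<alpha> < \<beta> \<Longrightarrow> hb_measure \<beta> \<nu> E = 0"
  shows "hb_dim \<nu> E \<le> ereal \<alpha>"
proof (rule dense_ge)
  fix z assume "ereal \<alpha> < z"
  from ereal_dense2[OF this] obtain \<beta> where \<beta>: "\<alpha> < \<beta>" "ereal \<beta> < z" by auto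
  have "hb_dim \<nu> E \<le> ereal \<beta>"
    unfolding hb_dim_def using assms \<beta> by (intro Inf_lower) auto
  then show "hb_dim \<nu> E \<le> z" using \<beta>(2) by simp
qed

lemma hb_measure_eq_0I:
  assumes "\<And>\<epsilon> \<delta>. 0 < \<epsilon> \<Longrightarrow> 0 < \<delta> \<Longrightarrow>
    \<exists>C\<in>interval_covers \<nu> E \<epsilon>. \<forall>F. finite F \<longrightarrow> F \<subseteq> C \<longrightarrow> (\<Sum>I\<in>F. measure \<nu> I powr \<beta>) \<le> \<delta>"
  shows "hb_measure \<beta> \<nu> E = 0"
proof -
  have "hb_premeasure \<beta> \<epsilon> \<nu> E \<le> 0" if \<epsilon>: "0 < \<epsilon>" for \<epsilon>
  proof (rule ennreal_le_epsilon)
    fix \<delta> :: real assume "0 < \<delta>"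
    from assms[OF \<epsilon> this] obtain C where C: "C \<in> interval_covers \<nu> E \<epsilon>"
      and le: "\<And>F. finite F \<Longrightarrow> F \<subseteq> C \<Longrightarrow> (\<Sum>I\<in>F. measure \<nu> I powr \<beta>) \<le> \<delta>" by blast
    have "hb_premeasure \<beta> \<epsilon> \<nu> E \<le> (\<Sum>\<^sub>\<infinity>I\<in>C. ennreal (measure \<nu> I powr \<beta>))"
      unfolding hb_premeasure_def by (rule INF_lower[OF C])
    also have "\<dots> = (SUP F\<in>{F. finite F \<and> F \<subseteq> C}. \<Sum>I\<in>F. ennreal (measure \<nu> I powr \<beta>))"
      by (rule nonneg_infsum_complete) simp
    also have "\<dots> \<le> ennreal \<delta>"
      by (rule SUP_least) (auto simp: sum_ennreal intro!: ennreal_leI le)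
    finally show "hb_premeasure \<beta> \<epsilon> \<nu> E \<le> 0 + ennreal \<delta>" by simp
  qed
  then have "(SUP \<epsilon>\<in>{0<..}. hb_premeasure \<beta> \<epsilon> \<nu> E) \<le> 0" by (intro SUP_least) auto
  then show ?thesis unfolding hb_measure_eq_SUP by simp
qed

text \<open>Countable subadditivity for an unordered family; the family is enumerated because infinite unordered
  sums and series in \<open>ennreal\<close> are different notions.\<close>

lemma emeasure_le_infsum:
  fixes f :: "'a set \<Rightarrow> ennreal"
  assumes A: "A \<in> sets M" and C: "countable C" "C \<subseteq> sets M" "A \<subseteq> \<Union>C"
    and le: "\<And>I. I \<in> C \<Longrightarrow> emeasure M (A \<inter> I) \<le> K * f I"
  shows "emeasure M A \<le> K * infsum f C"
proof (cases "finite C")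
  case True
  have "emeasure M A = emeasure M (\<Union>I\<in>C. A \<inter> I)"
    using C(3) by (intro arg_cong[of _ _ "emeasure M"]) auto
  also have "\<dots> \<le> (\<Sum>I\<in>C. emeasure M (A \<inter> I))"
    using True A C by (intro emeasure_subadditive_finite) auto
  also have "\<dots> \<le> (\<Sum>I\<in>C. K * f I)" by (intro sum_mono le)
  also have "\<dots> = K * infsum f C" using True by (simp add: sum_distrib_left)
  finally show ?thesis .
next
  case False
  let ?g = "from_nat_into C"
  have bij: "bij_betw ?g UNIV C" using C False by (intro bij_betw_from_nat_into) auto
  then have rng: "range ?g = C" by (rule bij_betw_imp_surj_on)
  then have gC: "?g i \<in> C" for i by auto
  have "(\<Union>i. A \<inter> ?g i) = A \<inter> \<Union>(range ?g)" by auto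
  also have "\<dots> = A" unfolding rng using C(3) by (rule Int_absorb2)
  finally have "emeasure M A = emeasure M (\<Union>i. A \<inter> ?g i)" by simp
  also have "\<dots> \<le> (\<Sum>i. emeasure M (A \<inter> ?g i))"
    using A C(2) gC by (intro emeasure_subadditive_countably) auto
  also have "\<dots> \<le> (\<Sum>i. K * f (?g i))" by (intro suminf_le le gC) auto
  also have "\<dots> = K * (\<Sum>i. f (?g i))" by (rule ennreal_suminf_cmult)
  also have "(\<Sum>i. f (?g i)) \<le> infsum (\<lambda>i. f (?g i)) UNIV"
    by (rule suminf_le_const) (auto simp: nonneg_infsum_complete intro!: SUP_upper)
  also have "\<dots> = infsum f C" by (rule infsum_reindex_bij_betw[OF bij])
  finally show ?thesis by (simp add: mult_left_mono)
qed

context superdecreasing_series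
begin

text \<open>For \<open>\<beta> > \<alpha>\<close> cover by all heavy cylinders of rank at least \<open>m\<close>. A heavy cylinder of rank \<open>n\<close>
  contributes \<open>2 powr (- \<beta> * n)\<close>, which is at most \<open>2 powr (- (\<beta> - \<alpha>) * n)\<close> times its weight. As the
  weights of one rank add up to 1, the cover costs no more than a geometric tail.\<close>

lemma hb_dim_le_if_frequently_heavy:
  assumes \<nu>: "digit_law (\<lambda>_. 1 / 2) \<nu>" and p: "\<And>k. 0 \<le> p k \<and> p k \<le> 1" and \<alpha>: "0 \<le> \<alpha>"
    and E: "\<And>x. x \<in> E \<Longrightarrow>
      \<exists>\<^sub>\<infinity>n. \<exists>W\<subseteq>{..<n}. x \<in> cyl n W \<and> 2 powr (- \<alpha> * n) \<le> word_prob p n W"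
  shows "hb_dim \<nu> E \<le> ereal \<alpha>"
proof (rule hb_dim_leI[OF \<alpha>], rule hb_measure_eq_0I)
  fix \<beta> \<epsilon> \<delta> :: real assume \<beta>: "\<alpha> < \<beta>" and \<epsilon>: "0 < \<epsilon>" and \<delta>: "0 < \<delta>"
  define x :: real where "x = 2 powr (- (\<beta> - \<alpha>))"
  have x: "0 < x" "x < 1" using \<beta> by (auto simp: x_def powr_less_one)
  have xn: "x ^ n = 2 powr (- (\<beta> - \<alpha>) * n)" for n
    unfolding x_def by (simp add: powr_power mult.commute)
  have "(\<lambda>m. x ^ m / (1 - x)) \<longlonglongrightarrow> 0 / (1 - x)"
    using x by (intro tendsto_intros LIMSEQ_power_zero) auto
  then have "\<forall>\<^sub>F m in sequentially. x ^ m / (1 - x) < \<delta>"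
    using \<delta> by (intro order_tendstoD) auto
  moreover have "\<forall>\<^sub>F m in sequentially. (1 / 2 :: real) ^ m < \<epsilon>"
    using \<epsilon> by (intro order_tendstoD(2)[OF LIMSEQ_power_zero]) auto
  ultimately have "\<forall>\<^sub>F m in sequentially. x ^ m / (1 - x) < \<delta> \<and> (1 / 2 :: real) ^ m < \<epsilon>"
    by (rule eventually_conj)
  then obtain m where m: "x ^ m / (1 - x) < \<delta>" "(1 / 2 :: real) ^ m < \<epsilon>"
    by (auto simp: eventually_sequentially)
  define G where "G n = {W \<in> Pow {..<n}. 2 powr (- \<alpha> * n) \<le> word_prob p n W}" for n :: nat
  have G: "G n \<subseteq> Pow {..<n}" "finite (G n)" for n by (auto simp: G_def)
  have \<nu>_cyl: "measure \<nu> (cyl n W) = (1 / 2) ^ n" if "W \<in> G n" for n W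
    using that G(1)[of n] digit_lawD(4)[OF \<nu>, of W n] by (auto simp: word_prob_half)
  define C where "C = (\<Union>n\<in>{m..}. cyl n ` G n)"
  have "C \<in> interval_covers \<nu> E \<epsilon>"
    unfolding interval_covers_def
  proof (intro CollectI conjI ballI)
    show "countable C" unfolding C_def by (intro countable_UN countable_image) (auto intro: countable_finite G)
    show "C \<subseteq> {{a..b} | a b. a \<le> b}" using cyl_interval unfolding C_def by blast
    show "E \<subseteq> \<Union> C"
    proof
      fix y assume "y \<in> E"
      from E[OF this] obtain n W where "n \<ge> m" "W \<subseteq> {..<n}" "y \<in> cyl n W"
        "2 powr (- \<alpha> * n) \<le> word_prob p n W"
        unfolding INFM_nat_le by blast
      then show "y \<in> \<Union> C" by (auto simp: C_def G_def)
    qed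
    fix I assume "I \<in> C"
    then obtain n W where "n \<ge> m" "W \<in> G n" "I = cyl n W" by (auto simp: C_def)
    then have "measure \<nu> I \<le> (1 / 2) ^ m" using \<nu>_cyl by (simp add: power_decreasing)
    then show "measure \<nu> I \<le> \<epsilon>" using m by simp
  qed
  moreover have "(\<Sum>I\<in>F. measure \<nu> I powr \<beta>) \<le> \<delta>" if F: "finite F" "F \<subseteq> C" for F
  proof -
    have "\<forall>I\<in>F. \<exists>n. m \<le> n \<and> I \<in> cyl n ` G n" using F unfolding C_def by blast
    then obtain N where N: "\<And>I. I \<in> F \<Longrightarrow> m \<le> N I \<and> I \<in> cyl (N I) ` G (N I)" by metis
    obtain r where r: "\<And>I. I \<in> F \<Longrightarrow> N I < r"
      using finite_nat_set_iff_bounded[of "N ` F"] F by auto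
    define D where "D = Sigma {m..<r} G"
    have D: "finite D" unfolding D_def using G by auto
    have "F \<subseteq> (\<lambda>(n, W). cyl n W) ` D"
      using N r unfolding D_def by (fastforce simp: image_iff)
    then have "(\<Sum>I\<in>F. measure \<nu> I powr \<beta>) \<le> (\<Sum>I\<in>(\<lambda>(n, W). cyl n W) ` D. measure \<nu> I powr \<beta>)"
      using D by (intro sum_mono2) auto
    also have "\<dots> \<le> (\<Sum>(n, W)\<in>D. measure \<nu> (cyl n W) powr \<beta>)"
      by (rule order_trans[OF sum_image_le[OF D]]) (auto simp: o_def case_prod_beta)
    also have "\<dots> = (\<Sum>n\<in>{m..<r}. \<Sum>W\<in>G n. measure \<nu> (cyl n W) powr \<beta>)"
      unfolding D_def using G by (intro sum.Sigma[symmetric]) auto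
    also have "\<dots> \<le> (\<Sum>n\<in>{m..<r}. x ^ n)"
    proof (rule sum_mono)
      fix n
      have "(\<Sum>W\<in>G n. measure \<nu> (cyl n W) powr \<beta>) \<le> (\<Sum>W\<in>G n. word_prob p n W * x ^ n)"
      proof (rule sum_mono)
        fix W assume W: "W \<in> G n"
        have "measure \<nu> (cyl n W) powr \<beta> = 2 powr (- \<alpha> * n) * x ^ n"
          unfolding \<nu>_cyl[OF W] half_power_powr xn by (simp add: algebra_simps flip: powr_add)
        also have "\<dots> \<le> word_prob p n W * x ^ n"
          using W x by (intro mult_right_mono) (auto simp: G_def)
        finally show "measure \<nu> (cyl n W) powr \<beta> \<le> word_prob p n W * x ^ n" .
      qed
      also have "\<dots> = (\<Sum>W\<in>G n. word_prob p n W) * x ^ n" by (rule sum_distrib_right[symmetric])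
      also have "\<dots> \<le> (\<Sum>W\<in>Pow {..<n}. word_prob p n W) * x ^ n"
        using G x by (intro mult_right_mono sum_mono2 word_prob_nonneg p) auto
      finally show "(\<Sum>W\<in>G n. measure \<nu> (cyl n W) powr \<beta>) \<le> x ^ n"
        by (simp add: sum_word_prob)
    qed
    also have "\<dots> \<le> x ^ m / (1 - x)"
    proof (cases "m \<le> r")
      case True
      have "(\<Sum>n\<in>{m..<r}. x ^ n) = (x ^ m - x ^ r) / (1 - x)"
        using sum_gp_strict[of x r] sum_gp_strict[of x m] x True
          sum.atLeastLessThan_concat[of 0 m r "\<lambda>n. x ^ n"]
        by (simp add: diff_divide_distrib lessThan_atLeast0)
      also have "\<dots> \<le> x ^ m / (1 - x)" using x by (intro divide_right_mono) auto
      finally show ?thesis .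
    qed (use x in simp)
    finally show ?thesis using m by simp
  qed
  ultimately show "\<exists>C\<in>interval_covers \<nu> E \<epsilon>. \<forall>F. finite F \<longrightarrow> F \<subseteq> C \<longrightarrow>
      (\<Sum>I\<in>F. measure \<nu> I powr \<beta>) \<le> \<delta>"
    by blast
qed

text \<open>Of the cylinders of rank \<open>n\<close> met by the interval, at most two contain an end point. The others lie
  inside it, are disjoint and have \<open>\<nu>\<close>-mass \<open>2 ^ - n\<close> each, which bounds their number.\<close>

lemma measure_interval_le_light_cyl:
  assumes \<nu>: "digit_law (\<lambda>_. 1 / 2) \<nu>" and \<rho>: "digit_law p \<rho>" and A: "A \<in> sets borel" and c: "0 \<le> c"
    and light: "\<And>W. W \<subseteq> {..<n} \<Longrightarrow> cyl n W \<inter> A \<noteq> {} \<Longrightarrow> word_prob p n W \<le> c"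
  shows "measure \<rho> (A \<inter> {l..u}) \<le> (2 + 2 ^ n * measure \<nu> {l..u}) * c"
proof -
  interpret \<nu>: prob_space \<nu> using \<nu> by (rule digit_lawD)
  interpret \<rho>: prob_space \<rho> using \<rho> by (rule digit_lawD)
  have [simp]: "sets \<nu> = sets borel" "sets \<rho> = sets borel"
    using digit_lawD(2)[OF \<nu>] digit_lawD(2)[OF \<rho>] by auto
  define T where "T = {W \<in> Pow {..<n}. cyl n W \<inter> (A \<inter> {l..u}) \<noteq> {}}"
  define T1 where "T1 = {W \<in> T. cyl n W \<subseteq> {l..u}}"
  define P where "P z = {W \<in> Pow {..<n}. z \<in> cyl n W}" for z
  have fin: "finite T" "finite T1" "finite (P z)" for z by (auto simp: T_def T1_def P_def)
  have P1: "card (P z) \<le> 1" for z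
    unfolding card_le_Suc0_iff_eq[OF fin(3)] One_nat_def using cyl_disjoint[of _ n]
    by (auto simp: P_def)
  have "T \<subseteq> T1 \<union> (P l \<union> P u)"
  proof
    fix W assume W: "W \<in> T"
    then have "cyl n W \<inter> {l..u} \<noteq> {}" by (auto simp: T_def)
    from cyl_met_by_interval[OF this] W show "W \<in> T1 \<union> (P l \<union> P u)"
      by (auto simp: T_def T1_def P_def)
  qed
  then have "card T \<le> card (T1 \<union> (P l \<union> P u))" by (intro card_mono) (use fin in auto)
  also have "\<dots> \<le> card T1 + (card (P l) + card (P u))"
    by (rule order_trans[OF card_Un_le]) (intro add_mono order_refl card_Un_le)
  also have "\<dots> \<le> card T1 + 2" using P1[of l] P1[of u] by simp
  finally have cardT: "real (card T) \<le> card T1 + 2" by simp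
  have "card T1 * (1 / 2) ^ n = (\<Sum>W\<in>T1. word_prob (\<lambda>_. 1 / 2) n W)"
    by (simp add: T1_def T_def word_prob_half)
  also have "\<dots> = measure \<nu> (\<Union>W\<in>T1. cyl n W)"
    by (rule measure_UN_cyl[OF \<nu>, symmetric]) (auto simp: T1_def T_def)
  also have "\<dots> \<le> measure \<nu> {l..u}"
    by (intro \<nu>.finite_measure_mono) (auto simp: T1_def)
  finally have cardT1: "card T1 \<le> 2 ^ n * measure \<nu> {l..u}"
    by (simp add: power_one_over field_simps)
  have "measure \<rho> (A \<inter> {l..u}) = measure \<rho> ((A \<inter> {l..u}) \<inter> (\<Union>W\<in>Pow {..<n}. cyl n W))"
  proof (rule measure_eq_AE)
    have "AE x in \<rho>. x \<in> (\<Union>W\<in>Pow {..<n}. cyl n W)"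
      by (subst \<rho>.AE_in_set_eq_1) (auto simp: measure_all_cyl[OF \<rho>])
    then show "AE x in \<rho>. x \<in> A \<inter> {l..u} \<longleftrightarrow> x \<in> A \<inter> {l..u} \<inter> (\<Union>W\<in>Pow {..<n}. cyl n W)"
      by eventually_elim auto
  qed (use A in auto)
  also have "\<dots> \<le> measure \<rho> (\<Union>W\<in>T. cyl n W)"
    by (intro \<rho>.finite_measure_mono) (use fin in \<open>auto simp: T_def\<close>)
  also have "\<dots> = (\<Sum>W\<in>T. word_prob p n W)"
    by (rule measure_UN_cyl[OF \<rho>]) (auto simp: T_def)
  also have "\<dots> \<le> (\<Sum>W\<in>T. c)" by (intro sum_mono light) (auto simp: T_def)
  also have "\<dots> = card T * c" by simp
  also have "\<dots> \<le> (2 + 2 ^ n * measure \<nu> {l..u}) * c"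
    using cardT cardT1 c by (intro mult_right_mono) auto
  finally show ?thesis .
qed

text \<open>The rank is chosen such that \<open>2 ^ - n\<close> and the \<open>\<nu>\<close>-mass of the interval agree up to a factor 2. A
  \<open>\<nu>\<close>-null interval admits every large rank, so its part in \<open>A\<close> is null for \<open>\<rho>\<close>.\<close>

lemma measure_interval_le_powr:
  assumes \<nu>: "digit_law (\<lambda>_. 1 / 2) \<nu>" and \<rho>: "digit_law p \<rho>" and A: "A \<in> sets borel" and \<beta>: "0 < \<beta>"
    and light: "\<And>n W. n \<ge> m \<Longrightarrow> W \<subseteq> {..<n} \<Longrightarrow> cyl n W \<inter> A \<noteq> {} \<Longrightarrow> word_prob p n W \<le> 2 powr (- \<beta> * n)"
    and small: "measure \<nu> {l..u} \<le> (1 / 2) ^ m"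
  shows "measure \<rho> (A \<inter> {l..u}) \<le> 3 * 2 powr \<beta> * measure \<nu> {l..u} powr \<beta>"
proof -
  define v where "v = measure \<nu> {l..u}"
  have bound: "measure \<rho> (A \<inter> {l..u}) \<le> (2 + 2 ^ n * v) * 2 powr (- \<beta> * n)" if "n \<ge> m" for n
    unfolding v_def by (rule measure_interval_le_light_cyl[OF \<nu> \<rho> A]) (use light[OF that] in auto)
  show ?thesis
  proof (cases "v = 0")
    case True
    have "(\<lambda>n. 2 * ((2 powr (- \<beta>)) ^ n)) \<longlonglongrightarrow> 2 * 0"
      using \<beta> by (intro tendsto_intros LIMSEQ_power_zero) (auto simp: powr_less_one)
    then have "measure \<rho> (A \<inter> {l..u}) \<le> 2 * 0"
      by (rule LIMSEQ_le_const) (use bound True in \<open>auto simp: powr_power mult.commute\<close>)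
    then show ?thesis using True by (simp add: v_def)
  next
    case False
    then have v: "0 < v" using measure_nonneg[of \<nu>] by (simp add: v_def less_le)
    obtain k0 where "(1 / 2 :: real) ^ k0 < v" using real_arch_pow_inv[OF v, of "1 / 2"] by auto
    define k where "k = (LEAST k. (1 / 2 :: real) ^ k < v)"
    have k: "(1 / 2 :: real) ^ k < v" unfolding k_def by (rule LeastI) fact
    have "(1 / 2 :: real) ^ k < (1 / 2) ^ m" using k small unfolding v_def by linarith
    then have "m < k" by (simp add: power_strict_decreasing_iff)
    then obtain n where n: "k = Suc n" "m \<le> n" by (cases k) auto
    have "v \<le> (1 / 2) ^ n"
      using not_less_Least[of n "\<lambda>k. (1 / 2 :: real) ^ k < v"] n unfolding k_def by simp
    then have "2 ^ n * v \<le> 1" by (simp add: power_one_over field_simps)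
    then have "measure \<rho> (A \<inter> {l..u}) \<le> 3 * 2 powr (- \<beta> * n)"
      by (intro order_trans[OF bound[OF n(2)]] mult_right_mono) auto
    also have "2 powr (- \<beta> * n) = ((1 / 2 :: real) ^ n) powr \<beta>" by (rule half_power_powr[symmetric])
    also have "\<dots> \<le> (2 * v) powr \<beta>" using k n \<beta> by (intro powr_mono2) auto
    also have "\<dots> = 2 powr \<beta> * v powr \<beta>" using v by (simp add: powr_mult)
    finally show ?thesis by (simp add: v_def)
  qed
qed

text \<open>The mass distribution principle: the pieces of any fine cover of \<open>E\<close> carry the whole mass of \<open>A\<close>,
  and a piece carries of it at most a constant times the power \<open>\<beta>\<close> of its \<open>\<nu>\<close>-mass.\<close>

lemma hb_dim_ge_if_eventually_light:
  assumes \<nu>: "digit_law (\<lambda>_. 1 / 2) \<nu>" and \<rho>: "digit_law p \<rho>"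
    and A: "A \<in> sets borel" "0 < measure \<rho> A" "A \<subseteq> E"
    and light: "\<And>n W. n \<ge> m \<Longrightarrow> W \<subseteq> {..<n} \<Longrightarrow> cyl n W \<inter> A \<noteq> {} \<Longrightarrow> word_prob p n W \<le> 2 powr (- \<alpha> * n)"
  shows "ereal \<alpha> \<le> hb_dim \<nu> E"
  unfolding hb_dim_def
proof (intro Inf_greatest, clarsimp, rule ccontr)
  fix \<beta> assume \<beta>: "0 < \<beta>" and zero: "hb_measure \<beta> \<nu> E = 0" and "\<not> \<alpha> \<le> \<beta>"
  interpret \<rho>: prob_space \<rho> using \<rho> by (rule digit_lawD)
  have sets_\<rho> [simp]: "sets \<rho> = sets borel" using digit_lawD(2)[OF \<rho>] .
  have light': "word_prob p n W \<le> 2 powr (- \<beta> * n)"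
    if "n \<ge> m" "W \<subseteq> {..<n}" "cyl n W \<inter> A \<noteq> {}" for n W
  proof (rule order_trans[OF light[OF that]])
    show "2 powr (- \<alpha> * n) \<le> 2 powr (- \<beta> * n)"
      using \<open>\<not> \<alpha> \<le> \<beta>\<close> by (intro powr_mono) (auto intro!: mult_right_mono)
  qed
  define K where "K = 3 * 2 powr \<beta>"
  have K: "0 < K" by (simp add: K_def)
  have "hb_premeasure \<beta> ((1 / 2) ^ m) \<nu> E \<le> 0"
    unfolding zero[symmetric] hb_measure_eq_SUP by (rule SUP_upper) auto
  also have "0 < ennreal (measure \<rho> A / K)" using A K by simp
  finally obtain C where C: "C \<in> interval_covers \<nu> E ((1 / 2) ^ m)"
    and less: "(\<Sum>\<^sub>\<infinity>I\<in>C. ennreal (measure \<nu> I powr \<beta>)) < ennreal (measure \<rho> A / K)"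
    unfolding hb_premeasure_def INF_less_iff by blast
  have "emeasure \<rho> A \<le> ennreal K * (\<Sum>\<^sub>\<infinity>I\<in>C. ennreal (measure \<nu> I powr \<beta>))"
  proof (rule emeasure_le_infsum)
    show "countable C" "C \<subseteq> sets \<rho>" "A \<subseteq> \<Union>C"
      using C A by (auto simp: interval_covers_def)
    fix I assume "I \<in> C"
    then obtain l u where I: "I = {l..u}" "measure \<nu> I \<le> (1 / 2) ^ m"
      using C by (auto simp: interval_covers_def)
    have "measure \<rho> (A \<inter> I) \<le> K * measure \<nu> I powr \<beta>"
      using I measure_interval_le_powr[OF \<nu> \<rho> A(1) \<beta> light'] by (simp add: K_def)
    then show "emeasure \<rho> (A \<inter> I) \<le> ennreal K * ennreal (measure \<nu> I powr \<beta>)"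
      using K by (simp add: \<rho>.emeasure_eq_measure flip: ennreal_mult)
  qed (use A in simp)
  also have "\<dots> < ennreal K * ennreal (measure \<rho> A / K)"
    using K less by (intro ennreal_mult_strict_left_mono) auto
  also have "\<dots> = emeasure \<rho> A"
    using K by (simp add: \<rho>.emeasure_eq_measure flip: ennreal_mult)
  finally show False by simp
qed

end

section \<open>The dimension of a digit law\<close>

lemma frequently_less_of_liminf_less:
  fixes X :: "nat \<Rightarrow> ereal"
  assumes "liminf X < c"
  shows "\<exists>\<^sub>F n in sequentially. X n < c"
proof (rule ccontr)
  assume "\<not> (\<exists>\<^sub>F n in sequentially. X n < c)"
  then have "\<forall>\<^sub>F n in sequentially. c \<le> X n" by (simp add: frequently_def not_less)
  then have "c \<le> liminf X" by (rule Liminf_bounded)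
  with assms show False by simp
qed

context superdecreasing_series
begin

text \<open>Above the lower entropy rate, infinitely many ranks have nearly full mass in heavy cylinders, so
  almost every point lies in heavy cylinders infinitely often; these points form a set of full measure
  to which the upper criterion applies. Below the rate, the masses of the heavy cylinders of rank \<open>n\<close>
  are summable, so that from any set of full measure the heavy cylinders of all large ranks can be
  removed without exhausting it, and the lower criterion applies to what is left.\<close>

lemma hb_dim_measure_eq_entropy_rate:
  assumes \<nu>: "digit_law (\<lambda>_. 1 / 2) \<nu>" and \<mu>: "digit_law p \<mu>"
  shows "hb_dim_measure \<mu> \<nu> =
    liminf (\<lambda>n. ereal ((\<Sum>k<n. bit_entropy (p k)) / (real n * ln 2)))" (is "_ = liminf (\<lambda>n. ereal (?r n))")
proof -
  interpret \<mu>: prob_space \<mu> using \<mu> by (rule digit_lawD)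
  have sets_\<mu> [simp]: "sets \<mu> = sets borel" using digit_lawD(2)[OF \<mu>] .
  have space_\<mu> [simp]: "space \<mu> = UNIV" using sets_eq_imp_space_eq[OF sets_\<mu>] by simp
  note p = digit_lawD(3)[OF \<mu>]
  define H where "H n = (\<Sum>k<n. bit_entropy (p k))" for n
  have H_nonneg: "0 \<le> H n" for n
    unfolding H_def using p by (intro sum_nonneg bit_entropy_bounds) auto
  have "hb_dim_measure \<mu> \<nu> \<le> liminf (\<lambda>n. ereal (?r n))"
  proof (rule dense_ge)
    fix z assume "liminf (\<lambda>n. ereal (?r n)) < z"
    from ereal_dense2[OF this] obtain \<alpha> where \<alpha>: "liminf (\<lambda>n. ereal (?r n)) < ereal \<alpha>" "ereal \<alpha> < z"
      by auto
    from ereal_dense2[OF \<alpha>(1)] obtain \<alpha>' where \<alpha>': "liminf (\<lambda>n. ereal (?r n)) < ereal \<alpha>'" "\<alpha>' < \<alpha>"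
      by auto
    have "0 \<le> liminf (\<lambda>n. ereal (?r n))"
      by (rule Liminf_bounded) (use H_nonneg in \<open>auto simp: H_def\<close>)
    from order.strict_trans1[OF this \<alpha>'(1)] have \<alpha>0: "0 < \<alpha>'" by simp
    have freq: "\<exists>\<^sub>F n in sequentially. H n \<le> \<alpha>' * n * ln 2"
      using frequently_less_of_liminf_less[OF \<alpha>'(1)]
    proof (rule frequently_elim1)
      fix n assume "ereal (?r n) < ereal \<alpha>'"
      then show "H n \<le> \<alpha>' * n * ln 2"
        by (cases "n = 0") (auto simp: H_def field_simps)
    qed
    define U where "U n = (\<Union>W\<in>{W \<in> Pow {..<n}. 2 powr (- \<alpha> * n) \<le> word_prob p n W}. cyl n W)" for n :: nat
    have U_sets [measurable]: "U n \<in> sets borel" for n unfolding U_def by (intro sets.finite_UN) auto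
    obtain c where c: "0 < c" and light: "\<And>n. H n \<le> \<alpha>' * n * ln 2 \<Longrightarrow>
        (\<Sum>W\<in>{W \<in> Pow {..<n}. word_prob p n W < 2 powr (- \<alpha> * n)}. word_prob p n W) \<le> exp (- c * n)"
      using light_words_improbable[of p \<alpha>' \<alpha>, OF p] \<alpha>' unfolding H_def by auto
    have U_large: "1 - exp (- c * n) \<le> measure \<mu> (U n)" if Hn: "H n \<le> \<alpha>' * n * ln 2" for n
    proof -
      have "(\<Sum>W\<in>Pow {..<n}. word_prob p n W)
          = (\<Sum>W\<in>{W \<in> Pow {..<n}. 2 powr (- \<alpha> * n) \<le> word_prob p n W}. word_prob p n W)
            + (\<Sum>W\<in>{W \<in> Pow {..<n}. word_prob p n W < 2 powr (- \<alpha> * n)}. word_prob p n W)"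
        by (subst sum.union_disjoint[symmetric]) (auto intro!: sum.cong)
      also have "(\<Sum>W\<in>{W \<in> Pow {..<n}. 2 powr (- \<alpha> * n) \<le> word_prob p n W}. word_prob p n W)
          = measure \<mu> (U n)"
        unfolding U_def by (rule measure_UN_cyl[OF \<mu>, symmetric]) auto
      finally show ?thesis using light[OF Hn] unfolding sum_word_prob by linarith
    qed
    \<comment> \<open>the cylinder of rank 0 has full measure and makes the set bounded\<close>
    define E where "E = {x. \<exists>\<^sub>\<infinity>n. x \<in> U n} \<inter> cyl 0 {}"
    have "AE x in \<mu>. \<forall>m. x \<in> (\<Union>n\<in>{m..}. U n)"
    proof (subst AE_all_countable, rule allI)
      fix m
      have "1 \<le> measure \<mu> (\<Union>n\<in>{m..}. U n)"
      proof (rule field_le_epsilon)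
        fix e :: real assume e: "0 < e"
        have "(\<lambda>n. exp (- c) ^ n) \<longlonglongrightarrow> 0" using c by (intro LIMSEQ_power_zero) auto
        then have "\<forall>\<^sub>F n in sequentially. exp (- c) ^ n < e" using e by (rule order_tendstoD)
        then have "\<forall>\<^sub>F n in sequentially. exp (- c) ^ n < e \<and> m \<le> n"
          using eventually_ge_at_top by (rule eventually_conj)
        from frequently_eventually_frequently[OF freq this] obtain n where
          n: "H n \<le> \<alpha>' * n * ln 2" "exp (- c) ^ n < e" "m \<le> n"
          by (auto dest: frequently_ex)
        have "exp (- c * n) = exp (- c) ^ n" by (simp add: exp_of_nat_mult[symmetric] mult.commute)
        then have "1 - e \<le> measure \<mu> (U n)" using U_large[OF n(1)] n(2) by simp
        also have "\<dots> \<le> measure \<mu> (\<Union>n\<in>{m..}. U n)"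
          using n(3) by (intro \<mu>.finite_measure_mono) auto
        finally show "1 \<le> measure \<mu> (\<Union>n\<in>{m..}. U n) + e" by simp
      qed
      then have "measure \<mu> (\<Union>n\<in>{m..}. U n) = 1" using \<mu>.prob_le_1 by (intro antisym) auto
      then show "AE x in \<mu>. x \<in> (\<Union>n\<in>{m..}. U n)" by (subst \<mu>.AE_in_set_eq_1) auto
    qed
    moreover have "AE x in \<mu>. x \<in> cyl 0 {}"
      using measure_all_cyl[OF \<mu>, of 0] by (subst \<mu>.AE_in_set_eq_1) auto
    ultimately have "AE x in \<mu>. x \<in> E"
      by eventually_elim (auto simp: E_def INFM_nat_le)
    moreover have E_sets: "E \<in> sets borel"
    proof -
      have "E = (\<Inter>m. \<Union>n\<in>{m..}. U n) \<inter> cyl 0 {}" by (auto simp: E_def INFM_nat_le)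
      then show ?thesis by simp
    qed
    ultimately have "measure \<mu> E = 1" by (subst (asm) \<mu>.AE_in_set_eq_1) auto
    moreover have "bounded E"
      by (rule bounded_subset[of "cyl 0 {}"]) (auto simp: E_def cyl_def)
    ultimately have "hb_dim_measure \<mu> \<nu> \<le> hb_dim \<nu> E"
      unfolding hb_dim_measure_def using E_sets by (intro INF_lower) auto
    also have "\<dots> \<le> ereal \<alpha>"
    proof (rule hb_dim_le_if_frequently_heavy[where p = p, OF \<nu> p])
      show "\<exists>\<^sub>\<infinity>n. \<exists>W\<subseteq>{..<n}. x \<in> cyl n W \<and> 2 powr (- \<alpha> * n) \<le> word_prob p n W" if "x \<in> E" for x
        using that unfolding E_def by (auto simp: U_def elim!: INFM_mono)
    qed (use \<alpha>0 \<alpha>' in simp)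
    finally show "hb_dim_measure \<mu> \<nu> \<le> z" using \<alpha>(2) by simp
  qed
  moreover have "liminf (\<lambda>n. ereal (?r n)) \<le> hb_dim_measure \<mu> \<nu>"
    unfolding hb_dim_measure_def
  proof (rule INF_greatest, clarsimp)
    fix E assume E: "E \<in> sets borel" "measure \<mu> E = 1"
    show "liminf (\<lambda>n. ereal (?r n)) \<le> hb_dim \<nu> E"
    proof (rule dense_le)
      fix z assume "z < liminf (\<lambda>n. ereal (?r n))"
      from ereal_dense2[OF this] obtain \<alpha> where \<alpha>: "z < ereal \<alpha>" "ereal \<alpha> < liminf (\<lambda>n. ereal (?r n))"
        by auto
      from ereal_dense2[OF \<alpha>(2)] obtain \<alpha>' where \<alpha>': "\<alpha> < \<alpha>'" "ereal \<alpha>' < liminf (\<lambda>n. ereal (?r n))"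
        by auto
      have "\<forall>\<^sub>F n in sequentially. \<alpha>' * n * ln 2 \<le> H n"
        using less_LiminfD[OF \<alpha>'(2)]
      proof eventually_elim
        case (elim n)
        then show ?case by (cases "n = 0") (auto simp: H_def field_simps)
      qed
      then obtain n1 where n1: "\<And>n. n \<ge> n1 \<Longrightarrow> \<alpha>' * n * ln 2 \<le> H n"
        by (auto simp: eventually_sequentially)
      define V where "V n = (\<Union>W\<in>{W \<in> Pow {..<n}. 2 powr (- \<alpha> * n) < word_prob p n W}. cyl n W)" for n :: nat
      have V_sets [measurable]: "V n \<in> sets borel" for n unfolding V_def by (intro sets.finite_UN) auto
      obtain c where c: "0 < c" and heavy: "\<And>n. \<alpha>' * n * ln 2 \<le> H n \<Longrightarrow>
          (\<Sum>W\<in>{W \<in> Pow {..<n}. 2 powr (- \<alpha> * n) < word_prob p n W}. word_prob p n W) \<le> exp (- c * n)"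
        using heavy_words_improbable[of p \<alpha> \<alpha>', OF p] \<alpha>' unfolding H_def by auto
      define y where "y = exp (- c)"
      have y: "0 < y" "y < 1" using c by (auto simp: y_def)
      have V_small: "measure \<mu> (V n) \<le> y ^ n" if "n \<ge> n1" for n
      proof -
        have "measure \<mu> (V n) = (\<Sum>W\<in>{W \<in> Pow {..<n}. 2 powr (- \<alpha> * n) < word_prob p n W}. word_prob p n W)"
          unfolding V_def by (rule measure_UN_cyl[OF \<mu>]) auto
        also have "\<dots> \<le> exp (- c * n)" by (rule heavy[OF n1[OF that]])
        also have "\<dots> = y ^ n" unfolding y_def by (simp add: exp_of_nat_mult[symmetric] mult.commute)
        finally show ?thesis .
      qed
      have "(\<lambda>m. y ^ m / (1 - y)) \<longlonglongrightarrow> 0 / (1 - y)"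
        using y by (intro tendsto_intros LIMSEQ_power_zero) auto
      then have "\<forall>\<^sub>F m in sequentially. y ^ m / (1 - y) < 1"
        by (intro order_tendstoD) auto
      then have "\<forall>\<^sub>F m in sequentially. y ^ m / (1 - y) < 1 \<and> n1 \<le> m"
        using eventually_ge_at_top by (rule eventually_conj)
      then obtain m where m: "y ^ m / (1 - y) < 1" "n1 \<le> m"
        by (auto simp: eventually_sequentially)
      have y_sums: "(\<lambda>i. y ^ (i + m)) sums (y ^ m / (1 - y))"
        using sums_mult[OF geometric_sums[of y], of "y ^ m"] y by (simp add: power_add mult.commute)
      have le: "measure \<mu> (V (i + m)) \<le> y ^ (i + m)" for i using m by (intro V_small) auto
      have smb: "summable (\<lambda>i. measure \<mu> (V (i + m)))"
        by (rule summable_comparison_test'[OF sums_summable[OF y_sums], of 0]) (use le in auto)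
      have "measure \<mu> (\<Union>i. V (i + m)) \<le> (\<Sum>i. measure \<mu> (V (i + m)))"
        by (rule \<mu>.finite_measure_subadditive_countably[OF _ smb]) auto
      also have "\<dots> \<le> (\<Sum>i. y ^ (i + m))"
        by (intro suminf_le smb sums_summable[OF y_sums] le)
      also have "\<dots> < 1" using m sums_unique[OF y_sums] by simp
      finally have V1: "measure \<mu> (\<Union>i. V (i + m)) < 1" .
      define A where "A = E - (\<Union>i. V (i + m))"
      have A_sets: "A \<in> sets borel" unfolding A_def using E by (intro sets.Diff) auto
      have VU: "(\<Union>i. V (i + m)) \<in> sets borel" by auto
      have "1 \<le> measure \<mu> (A \<union> (\<Union>i. V (i + m)))"
        unfolding E(2)[symmetric]
      proof (rule \<mu>.finite_measure_mono)
        show "E \<subseteq> A \<union> (\<Union>i. V (i + m))" by (auto simp: A_def)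
        show "A \<union> (\<Union>i. V (i + m)) \<in> sets \<mu>" unfolding sets_\<mu> using A_sets VU by (rule sets.Un)
      qed
      also have "\<dots> \<le> measure \<mu> A + measure \<mu> (\<Union>i. V (i + m))"
        using A_sets VU by (intro measure_Un_le) auto
      finally have A_pos: "0 < measure \<mu> A" using V1 by simp
      have "ereal \<alpha> \<le> hb_dim \<nu> E"
      proof (rule hb_dim_ge_if_eventually_light[OF \<nu> \<mu> A_sets A_pos])
        show "A \<subseteq> E" by (auto simp: A_def)
        fix n W assume "n \<ge> m" and W: "W \<subseteq> {..<n}" "cyl n W \<inter> A \<noteq> {}"
        then obtain i where i: "n = i + m" by (metis le_add_diff_inverse2)
        show "word_prob p n W \<le> 2 powr (- \<alpha> * n)"
        proof (rule ccontr)
          assume "\<not> word_prob p n W \<le> 2 powr (- \<alpha> * n)"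
          then have "cyl n W \<subseteq> V n" using W by (auto simp: V_def)
          then show False using W unfolding A_def i by blast
        qed
      qed
      then show "z \<le> hb_dim \<nu> E" using \<alpha>(1) by simp
    qed
  qed
  ultimately show ?thesis by (rule antisym)
qed

end

section \<open>The dimension of the spectrum\<close>

context superdecreasing_series
begin

text \<open>The cylinders of positive mass of one rank form a closed set of full measure. Conversely, a closed
  set that misses a point misses a small cylinder around it, and then cannot have full measure if this
  cylinder has positive mass.\<close>

lemma spectrum_digit_law:
  assumes \<mu>: "digit_law p \<mu>"
  shows "spectrum \<mu> = (\<Inter>n. \<Union>W\<in>{W \<in> Pow {..<n}. 0 < word_prob p n W}. cyl n W)"
proof -
  interpret \<mu>: prob_space \<mu> using \<mu> by (rule digit_lawD)
  have sets_\<mu> [simp]: "sets \<mu> = sets borel" using digit_lawD(2)[OF \<mu>] .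
  note p = digit_lawD(3)[OF \<mu>]
  define F where "F n = (\<Union>W\<in>{W \<in> Pow {..<n}. 0 < word_prob p n W}. cyl n W)" for n
  have closed_F: "closed (F n)" for n unfolding F_def by (intro closed_UN) (auto intro: closed_cyl)
  have F1: "measure \<mu> (F n) = 1" for n
  proof -
    have "measure \<mu> (F n) = (\<Sum>W\<in>{W \<in> Pow {..<n}. 0 < word_prob p n W}. word_prob p n W)"
      unfolding F_def by (rule measure_UN_cyl[OF \<mu>]) auto
    also have "\<dots> = (\<Sum>W\<in>Pow {..<n}. word_prob p n W)"
      using word_prob_nonneg[of p n, OF p] by (intro sum.mono_neutral_left) (auto simp: less_le)
    finally show ?thesis by (simp add: sum_word_prob)
  qed
  have "x \<in> Z" if x: "\<And>n. x \<in> F n" and Z: "closed Z" "measure \<mu> Z = 1" for x Z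
  proof (rule ccontr)
    assume "x \<notin> Z"
    then have "open (- Z)" "x \<in> - Z" using Z by (auto simp: open_Compl)
    then obtain e where e: "0 < e" "ball x e \<subseteq> - Z" by (auto simp: open_contains_ball)
    have "\<forall>\<^sub>F n in sequentially. neg_tail n + pos_tail n < e"
      using tail_tendsto_0 e(1) by (rule order_tendstoD)
    then obtain n where n: "neg_tail n + pos_tail n < e" by (auto simp: eventually_sequentially)
    obtain W where W: "W \<subseteq> {..<n}" "0 < word_prob p n W" "x \<in> cyl n W"
      using x[of n] by (auto simp: F_def)
    have "cyl n W \<subseteq> ball x e" using W(3) n by (auto simp: cyl_def dist_real_def)
    then have disj: "Z \<inter> cyl n W = {}" using e by auto
    have "measure \<mu> (Z \<union> cyl n W) = measure \<mu> Z + measure \<mu> (cyl n W)"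
      using disj Z by (intro \<mu>.finite_measure_Union) auto
    also have "\<dots> > 1" using Z W digit_lawD(4)[OF \<mu> W(1)] by simp
    finally show False using \<mu>.prob_le_1[of "Z \<union> cyl n W"] by simp
  qed
  then show ?thesis
    using closed_F F1 unfolding spectrum_def F_def[symmetric] by auto
qed

lemma word_prob_pos_iff:
  assumes p: "\<And>k. 0 \<le> p k \<and> p k \<le> 1" and W: "W \<subseteq> {..<n}"
  shows "0 < word_prob p n W \<longleftrightarrow> (\<forall>k<n. if k \<in> W then p k \<noteq> 0 else p k \<noteq> 1)"
proof -
  have "0 < word_prob p n W \<longleftrightarrow> word_prob p n W \<noteq> 0"
    using word_prob_nonneg[of p n W, OF p] by (simp add: less_le)
  also have "\<dots> \<longleftrightarrow> (\<forall>k<n. if k \<in> W then p k \<noteq> 0 else p k \<noteq> 1)"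
    unfolding word_prob_eq_prod[OF W] by auto
  finally show ?thesis .
qed

text \<open>These digit probabilities have the same possible words as \<open>p\<close>, but make them equally likely at each
  length.\<close>

definition fair_where_random :: "(nat \<Rightarrow> real) \<Rightarrow> nat \<Rightarrow> real" where
  "fair_where_random p k = (if 0 < p k \<and> p k < 1 then 1 / 2 else p k)"

lemma word_prob_fair_where_random:
  assumes p: "\<And>k. 0 \<le> p k \<and> p k \<le> 1" and W: "W \<subseteq> {..<n}"
  shows "word_prob (fair_where_random p) n W =
    (if 0 < word_prob p n W then (1 / 2) ^ card {k. k < n \<and> 0 < p k \<and> p k < 1} else 0)"
proof (cases "0 < word_prob p n W")
  case True
  then have nz: "\<forall>k<n. if k \<in> W then p k \<noteq> 0 else p k \<noteq> 1" using word_prob_pos_iff[OF p W] by simp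
  have "word_prob (fair_where_random p) n W = (\<Prod>k<n. if 0 < p k \<and> p k < 1 then 1 / 2 else 1)"
    unfolding word_prob_eq_prod[OF W]
  proof (intro prod.cong refl)
    fix k assume "k \<in> {..<n}"
    then have "if k \<in> W then p k \<noteq> 0 else p k \<noteq> 1" using nz by blast
    then show "(if k \<in> W then fair_where_random p k else 1 - fair_where_random p k)
        = (if 0 < p k \<and> p k < 1 then 1 / 2 else 1)"
      using p[of k] by (auto simp: fair_where_random_def split: if_splits)
  qed
  also have "\<dots> = (1 / 2) ^ card {k. k < n \<and> 0 < p k \<and> p k < 1}"
    by (simp add: prod.If_cases Int_def)
  finally show ?thesis using True by simp
next
  case False
  have p': "0 \<le> fair_where_random p k \<and> fair_where_random p k \<le> 1" for k
    using p[of k] by (simp add: fair_where_random_def)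
  have "\<not> 0 < word_prob (fair_where_random p) n W"
    using False unfolding word_prob_pos_iff[OF p W] word_prob_pos_iff[of "fair_where_random p", OF p' W]
    by (force simp: fair_where_random_def split: if_splits)
  then show ?thesis using False word_prob_nonneg[of "fair_where_random p" n W, OF p'] by simp
qed

text \<open>With respect to \<open>\<rho>\<close> the spectrum of \<open>\<mu>\<close> has full measure, and every cylinder of rank \<open>n\<close> around one of
  its points has mass \<open>2\<close> to the minus the number of random digits among the first \<open>n\<close>, so heavy and light depend on
  the rank alone.\<close>

lemma hb_dim_spectrum_eq_density:
  assumes \<nu>: "digit_law (\<lambda>_. 1 / 2) \<nu>" and \<mu>: "digit_law p \<mu>" and \<rho>: "digit_law (fair_where_random p) \<rho>"
  shows "hb_dim \<nu> (spectrum \<mu>) =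
    liminf (\<lambda>n. ereal (real (card {k. k < n \<and> 0 < p k \<and> p k < 1}) / real n))"
    (is "_ = liminf (\<lambda>n. ereal (real (?N n) / real n))")
proof -
  interpret \<rho>: prob_space \<rho> using \<rho> by (rule digit_lawD)
  have sets_\<rho> [simp]: "sets \<rho> = sets borel" using digit_lawD(2)[OF \<rho>] .
  note p = digit_lawD(3)[OF \<mu>]
  note wp = word_prob_fair_where_random[of p, OF p]
  let ?F = "\<lambda>n. \<Union>W\<in>{W \<in> Pow {..<n}. 0 < word_prob p n W}. cyl n W"
  have S: "spectrum \<mu> = (\<Inter>n. ?F n)" by (rule spectrum_digit_law[OF \<mu>])
  have F_sets: "?F n \<in> sets borel" for n by (intro sets.finite_UN) auto
  then have S_sets: "spectrum \<mu> \<in> sets borel" unfolding S by (intro sets.countable_INT') auto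
  have F1: "measure \<rho> (?F n) = 1" for n
  proof -
    have "measure \<rho> (?F n) = (\<Sum>W\<in>{W \<in> Pow {..<n}. 0 < word_prob p n W}. word_prob (fair_where_random p) n W)"
      by (rule measure_UN_cyl[OF \<rho>]) auto
    also have "\<dots> = (\<Sum>W\<in>Pow {..<n}. word_prob (fair_where_random p) n W)"
      by (intro sum.mono_neutral_left) (auto simp: wp)
    finally show ?thesis by (simp add: sum_word_prob)
  qed
  have "AE x in \<rho>. \<forall>n. x \<in> ?F n"
  proof (subst AE_all_countable, rule allI)
    fix n
    show "AE x in \<rho>. x \<in> ?F n"
      by (subst \<rho>.AE_in_set_eq_1) (simp_all only: sets_\<rho> F_sets F1)
  qed
  then have "AE x in \<rho>. x \<in> spectrum \<mu>" unfolding S by simp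
  then have S1: "measure \<rho> (spectrum \<mu>) = 1" using S_sets by (subst (asm) \<rho>.AE_in_set_eq_1) auto
  have "hb_dim \<nu> (spectrum \<mu>) \<le> liminf (\<lambda>n. ereal (real (?N n) / real n))"
  proof (rule dense_ge)
    fix z assume "liminf (\<lambda>n. ereal (real (?N n) / real n)) < z"
    from ereal_dense2[OF this] obtain \<alpha> where
      \<alpha>: "liminf (\<lambda>n. ereal (real (?N n) / real n)) < ereal \<alpha>" "ereal \<alpha> < z" by auto
    have "0 \<le> liminf (\<lambda>n. ereal (real (?N n) / real n))" by (rule Liminf_bounded) auto
    from order.strict_trans1[OF this \<alpha>(1)] have \<alpha>0: "0 \<le> \<alpha>" by simp
    have freq: "\<exists>\<^sub>\<infinity>n. ?N n \<le> \<alpha> * n"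
      unfolding cofinite_eq_sequentially using frequently_less_of_liminf_less[OF \<alpha>(1)]
    proof (rule frequently_elim1)
      fix n assume "ereal (real (?N n) / real n) < ereal \<alpha>"
      then show "?N n \<le> \<alpha> * n" by (cases "n = 0") (auto simp: field_simps)
    qed
    have "hb_dim \<nu> (spectrum \<mu>) \<le> ereal \<alpha>"
    proof (rule hb_dim_le_if_frequently_heavy[OF \<nu> digit_lawD(3)[OF \<rho>] \<alpha>0])
      fix x assume x: "x \<in> spectrum \<mu>"
      show "\<exists>\<^sub>\<infinity>n. \<exists>W\<subseteq>{..<n}. x \<in> cyl n W \<and> 2 powr (- \<alpha> * n) \<le> word_prob (fair_where_random p) n W"
        using freq
      proof (rule INFM_mono)
        fix n assume n: "?N n \<le> \<alpha> * n"
        obtain W where W: "W \<subseteq> {..<n}" "0 < word_prob p n W" "x \<in> cyl n W"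
          using x unfolding S by auto
        have "2 powr (- \<alpha> * n) \<le> 2 powr (- real (?N n))" using n by (intro powr_mono) auto
        also have "\<dots> = word_prob (fair_where_random p) n W"
          using W by (simp add: wp flip: half_power_eq_powr)
        finally show "\<exists>W\<subseteq>{..<n}. x \<in> cyl n W \<and> 2 powr (- \<alpha> * n) \<le> word_prob (fair_where_random p) n W"
          using W by blast
      qed
    qed
    then show "hb_dim \<nu> (spectrum \<mu>) \<le> z" using \<alpha>(2) by simp
  qed
  moreover have "liminf (\<lambda>n. ereal (real (?N n) / real n)) \<le> hb_dim \<nu> (spectrum \<mu>)"
  proof (rule dense_le)
    fix z assume "z < liminf (\<lambda>n. ereal (real (?N n) / real n))"
    from ereal_dense2[OF this] obtain \<alpha> where
      \<alpha>: "z < ereal \<alpha>" "ereal \<alpha> < liminf (\<lambda>n. ereal (real (?N n) / real n))" by auto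
    have "\<forall>\<^sub>F n in sequentially. \<alpha> * n \<le> ?N n"
      using less_LiminfD[OF \<alpha>(2)]
    proof eventually_elim
      case (elim n)
      then show ?case by (cases "n = 0") (auto simp: field_simps)
    qed
    then obtain m where m: "\<And>n. n \<ge> m \<Longrightarrow> \<alpha> * n \<le> ?N n" by (auto simp: eventually_sequentially)
    have "ereal \<alpha> \<le> hb_dim \<nu> (spectrum \<mu>)"
    proof (rule hb_dim_ge_if_eventually_light[OF \<nu> \<rho> S_sets])
      fix n W assume n: "n \<ge> m" and W: "W \<subseteq> {..<n}"
      have "word_prob (fair_where_random p) n W \<le> 2 powr (- real (?N n))"
        using W by (simp add: wp flip: half_power_eq_powr)
      also have "\<dots> \<le> 2 powr (- \<alpha> * n)" using m[OF n] by (intro powr_mono) auto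
      finally show "word_prob (fair_where_random p) n W \<le> 2 powr (- \<alpha> * n)" .
    qed (use S1 in auto)
    then show "z \<le> hb_dim \<nu> (spectrum \<mu>)" using \<alpha>(1) by simp
  qed
  ultimately show ?thesis by (rule antisym)
qed

end

section \<open>Ostrogradsky series\<close>

text \<open>The tail behind index \<open>k\<close> is at most the geometric sum \<open>3/2 * u (k + 1)\<close>, hence at most
  \<open>3/4 * u k\<close>. Halving alone would not suffice, since it only gives the bound \<open>u k\<close>.\<close>

lemma superdecreasing_reciprocals:
  fixes a u :: "nat \<Rightarrow> real"
  assumes pos: "\<And>k. 0 < u k" and half: "\<And>k. u (Suc k) \<le> u k / 2"
    and third: "\<And>k. u (Suc (Suc k)) \<le> u (Suc k) / 3" and a: "\<And>k. \<bar>a k\<bar> = u k"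
  shows "superdecreasing_series a"
proof
  have geo: "u (j + Suc k) \<le> u (Suc k) * (1/3) ^ j" for j k
  proof (induction j)
    case (Suc j)
    have "u (Suc j + Suc k) \<le> u (j + Suc k) / 3" using third[of "j + k"] by simp
    with Suc show ?case by simp
  qed simp
  have sg: "summable (\<lambda>j. u (Suc k) * (1/3) ^ j)" for k
    by (intro summable_mult summable_geometric) auto
  have s: "summable (\<lambda>j. u (j + Suc k))" for k
    by (rule summable_comparison_test'[OF sg[of k], of 0]) (use geo pos in \<open>auto simp: less_imp_le\<close>)
  show "summable (\<lambda>k. \<bar>a k\<bar>)"
    unfolding a using s[of 0] by (subst (asm) summable_iff_shift)
  fix k
  have "(\<Sum>j. u (j + Suc k)) \<le> (\<Sum>j. u (Suc k) * (1/3) ^ j)"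
    by (intro suminf_le s sg geo)
  also have "\<dots> = u (Suc k) * (3/2)"
    by (subst suminf_mult) (auto simp: suminf_geometric)
  also have "\<dots> \<le> u k * (3/4)" using half[of k] by simp
  also have "\<dots> < u k" using pos[of k] by simp
  finally show "(\<Sum>j. \<bar>a (j + Suc k)\<bar>) < \<bar>a k\<bar>" unfolding a .
qed

text \<open>Since \<open>q k * (q k + 1)\<close> is at least twice \<open>q k\<close>, all denominators but the first are at least 2, and
  from there on they grow by a factor of at least 3.\<close>

lemma superdecreasing_ostrogradsky:
  fixes q :: "nat \<Rightarrow> nat"
  assumes q_pos: "\<And>k. k \<ge> 1 \<Longrightarrow> q k > 0"
    and q_growth: "\<And>k. k \<ge> 1 \<Longrightarrow> q (k + 1) \<ge> q k * (q k + 1)"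
  shows "superdecreasing_series (\<lambda>k. (-1) ^ (Suc k + 1) / real (q (Suc k)))"
proof (rule superdecreasing_reciprocals[where u = "\<lambda>k. 1 / real (q (Suc k))"])
  have q1: "1 \<le> q (Suc k)" for k using q_pos[of "Suc k"] by simp
  have step: "c * q (Suc k) \<le> q (Suc (Suc k))" if "c \<le> q (Suc k) + 1" for c k
  proof -
    have "c * q (Suc k) \<le> q (Suc k) * (q (Suc k) + 1)"
      using that by (subst mult.commute) (rule mult_left_mono, auto)
    also have "\<dots> \<le> q (Suc (Suc k))" using q_growth[of "Suc k"] by simp
    finally show ?thesis .
  qed
  fix k
  show "0 < 1 / real (q (Suc k))" using q1[of k] by simp
  have two: "2 * q (Suc k) \<le> q (Suc (Suc k))" for k using q1[of k] by (intro step) simp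
  have "3 * q (Suc (Suc k)) \<le> q (Suc (Suc (Suc k)))"
    using two[of k] q1[of k] by (intro step) simp
  then have "3 * real (q (Suc (Suc k))) \<le> real (q (Suc (Suc (Suc k))))" by linarith
  then show "1 / real (q (Suc (Suc (Suc k)))) \<le> 1 / real (q (Suc (Suc k))) / 3"
    using q1[of "Suc k"] q1[of "Suc (Suc k)"] by (simp add: field_simps)
  have "2 * real (q (Suc k)) \<le> real (q (Suc (Suc k)))" using two[of k] by linarith
  then show "1 / real (q (Suc (Suc k))) \<le> 1 / real (q (Suc k)) / 2"
    using q1[of k] q1[of "Suc k"] by (simp add: field_simps)
  show "\<bar>(-1) ^ (Suc k + 1) / real (q (Suc k))\<bar> = 1 / real (q (Suc k))"
    by (simp add: abs_divide power_abs)
qed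

theorem theorem8:
  fixes q :: "nat \<Rightarrow> nat"
    and M :: "'a measure" and \<xi> :: "nat \<Rightarrow> 'a \<Rightarrow> real"
    and M' :: "'b measure" and \<epsilon> :: "nat \<Rightarrow> 'b \<Rightarrow> real"
    and p0 p1 h H :: "nat \<Rightarrow> real" and N :: "nat \<Rightarrow> nat"
    and \<mu> \<nu>r :: "real measure"
  assumes q_pos: "\<And>k. k \<ge> 1 \<Longrightarrow> q k > 0"
    and q_growth: "\<And>k. k \<ge> 1 \<Longrightarrow> q (k + 1) \<ge> q k * (q k + 1)"
    and M: "prob_space M"
    and \<xi>_indep: "prob_space.indep_vars M (\<lambda>_. borel) \<xi> {1..}"
    and \<xi>_0: "\<And>k. k \<ge> 1 \<Longrightarrow> \<P>(\<omega> in M. \<xi> k \<omega> = 0) = p0 k"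
    and \<xi>_1: "\<And>k. k \<ge> 1 \<Longrightarrow> \<P>(\<omega> in M. \<xi> k \<omega> = 1) = p1 k"
    and p_nonneg: "\<And>k. k \<ge> 1 \<Longrightarrow> p0 k \<ge> 0 \<and> p1 k \<ge> 0"
    and p_sum: "\<And>k. k \<ge> 1 \<Longrightarrow> p0 k + p1 k = 1"
    and p_inf: "infinite {k. k \<ge> 1 \<and> max (p0 k) (p1 k) < 1}"
    and \<mu>: "\<mu> = distr M borel (\<lambda>\<omega>. ostrogradsky_sum q (\<lambda>k. \<xi> k \<omega>))"
    and M': "prob_space M'"
    and \<epsilon>_indep: "prob_space.indep_vars M' (\<lambda>_. borel) \<epsilon> {1..}"
    and \<epsilon>_0: "\<And>k. k \<ge> 1 \<Longrightarrow> \<P>(\<omega> in M'. \<epsilon> k \<omega> = 0) = 1 / 2"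
    and \<epsilon>_1: "\<And>k. k \<ge> 1 \<Longrightarrow> \<P>(\<omega> in M'. \<epsilon> k \<omega> = 1) = 1 / 2"
    and \<nu>r: "\<nu>r = distr M' borel (\<lambda>\<omega>. ostrogradsky_sum q (\<lambda>k. \<epsilon> k \<omega>))"
    and h: "\<And>n. n \<ge> 1 \<Longrightarrow> h n = - (p0 n * ln (p0 n) + p1 n * ln (p1 n))"
    and H: "\<And>n. H n = (\<Sum>k=1..n. h k)"
    and N: "\<And>k. N k = card {j. 1 \<le> j \<and> j \<le> k \<and> p0 j * p1 j > 0}"
  shows "hb_dim_measure \<mu> \<nu>r = liminf (\<lambda>n. ereal (H n / (real n * ln 2)))
       \<and> hb_dim \<nu>r (spectrum \<mu>) = liminf (\<lambda>k. ereal (real (N k) / real k))"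
proof
  define a :: "nat \<Rightarrow> real" where "a k = (-1) ^ (Suc k + 1) / real (q (Suc k))" for k
  define p where "p k = p1 (Suc k)" for k
  have a_eq: "ostrogradsky_sum q x = (\<Sum>k. a k * x (Suc k))" for x
    unfolding ostrogradsky_sum_def a_def by (intro suminf_cong) simp
  interpret superdecreasing_series a
    unfolding a_def using q_pos q_growth by (rule superdecreasing_ostrogradsky)
  have p0: "p0 (Suc k) = 1 - p k" for k using p_sum[of "Suc k"] by (simp add: p_def)
  have p_bounds: "0 \<le> p k \<and> p k \<le> 1" for k
    using p_nonneg[of "Suc k"] p0[of k] by (simp add: p_def)
  have \<mu>_law: "digit_law p \<mu>"
    unfolding \<mu> a_eq
    by (rule digit_law_distr[OF M \<xi>_indep]) (simp_all add: \<xi>_1 \<xi>_0 p0 flip: p_def)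
  have \<nu>_law: "digit_law (\<lambda>_. 1 / 2) \<nu>r"
    unfolding \<nu>r a_eq
    by (rule digit_law_distr[OF M' \<epsilon>_indep]) (simp_all add: \<epsilon>_1 \<epsilon>_0)
  \<comment> \<open>the fair digits of \<open>\<nu>r\<close>, held constant where the digit of \<open>\<mu>\<close> is deterministic, realise the law that is
    used for the spectrum\<close>
  define Y where "Y k x = (if 0 < p (k - 1) \<and> p (k - 1) < 1 then x else p (k - 1))" for k x
  have "digit_law (fair_where_random p) (distr M' borel (\<lambda>\<omega>. \<Sum>k. a k * Y (Suc k) (\<epsilon> (Suc k) \<omega>)))"
  proof (rule digit_law_distr[OF M'])
    interpret M': prob_space M' by (rule M')
    show "M'.indep_vars (\<lambda>_. borel) (\<lambda>k \<omega>. Y k (\<epsilon> k \<omega>)) {1..}"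
      by (rule M'.indep_vars_compose2[OF \<epsilon>_indep]) (simp add: Y_def)
    fix k
    show "\<P>(\<omega> in M'. Y (Suc k) (\<epsilon> (Suc k) \<omega>) = 1) = fair_where_random p k"
      using p_bounds[of k] \<epsilon>_1[of "Suc k"] M'.prob_space by (auto simp: Y_def fair_where_random_def)
    show "\<P>(\<omega> in M'. Y (Suc k) (\<epsilon> (Suc k) \<omega>) = 0) = 1 - fair_where_random p k"
      using p_bounds[of k] \<epsilon>_0[of "Suc k"] M'.prob_space by (auto simp: Y_def fair_where_random_def)
  qed
  note \<rho>_law = this
  have H_eq: "H n = (\<Sum>k<n. bit_entropy (p k))" for n
  proof -
    have "h (Suc k) = bit_entropy (p k)" for k
      by (simp add: h bit_entropy_def p0 flip: p_def)
    then show ?thesis unfolding H by (simp add: sum.atLeast1_atMost_eq)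
  qed
  show "hb_dim_measure \<mu> \<nu>r = liminf (\<lambda>n. ereal (H n / (real n * ln 2)))"
    unfolding H_eq by (rule hb_dim_measure_eq_entropy_rate[OF \<nu>_law \<mu>_law])
  have N_eq: "N n = card {k. k < n \<and> 0 < p k \<and> p k < 1}" for n
  proof -
    have "{j. 1 \<le> j \<and> j \<le> n \<and> p0 j * p1 j > 0} = Suc ` {k. k < n \<and> 0 < p k \<and> p k < 1}"
    proof (intro set_eqI iffI)
      fix j assume j: "j \<in> {j. 1 \<le> j \<and> j \<le> n \<and> p0 j * p1 j > 0}"
      then obtain k where k: "j = Suc k" by (cases j) auto
      then show "j \<in> Suc ` {k. k < n \<and> 0 < p k \<and> p k < 1}"
        using j p_bounds[of k] by (auto simp: p0 zero_less_mult_iff simp flip: p_def)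
    next
      fix j assume "j \<in> Suc ` {k. k < n \<and> 0 < p k \<and> p k < 1}"
      then show "j \<in> {j. 1 \<le> j \<and> j \<le> n \<and> p0 j * p1 j > 0}"
        by (auto simp: p0 simp flip: p_def)
    qed
    then show ?thesis unfolding N by (simp add: card_image)
  qed
  show "hb_dim \<nu>r (spectrum \<mu>) = liminf (\<lambda>k. ereal (real (N k) / real k))"
    unfolding N_eq by (rule hb_dim_spectrum_eq_density[OF \<nu>_law \<mu>_law \<rho>_law])
qed

end
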